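(* Let $X_1,X_2,\dots$ be random variables such that for each $i\ge1$, $X_i\in\mathcal H_i$, $X_i$ is independent of $\mathcal F_{i-1}$, and $X_i$ is either bounded below or belongs to $L^1_b$. Let $(b_n)$ be an increasing sequence of positive numbers with $b_n\to\infty$. If $\sum_{n=1}^\infty \mathcal E\big((X_n-\mathcal E(X_n))^2\big)/b_n^2<\infty$, then $\frac1{b_n}\sum_{i=1}^n(X_i-\mathcal E(X_i))\to0$ quasi-surely as $n\to\infty$.
   Context: Standing setting. $(\Omega,\mathcal F)$ is a measurable space with a discrete-time filtration $(\mathcal F_t)_{t\in\mathbb N}$, $\mathcal F_0$ trivial and $\mathcal F=\sigma(\bigcup_t\mathcal F_t)$. $\mathcal H$ is a linear space of $\mathcal F$-measurable real functions on $\Omega$ containing the constants, such that $X\in\mathcal H$ implies $|X|\in\mathcal H$ and $I_AX\in\mathcal H$ for all $A\in\mathcal F$; $\mathcal H_t:=\{X\in\mathcal H: X \text{ is } \mathcal F_t\text{-measurable}\}$. $(\mathcal E_t)$ is an $\mathcal{SL}$-expectation (a family of maps $\mathcal E_t:\mathcal H\to\mathcal H_t$ that are monotone, time-consistent $\mathcal E_s\circ\mathcal E_t=\mathcal E_s$ for $s\le t$, satisfy $\mathcal E_t(I_AY)=I_A\mathcal E_t(Y)$ for $A\in\mathcal F_t$, $\mathcal E_t(Y)=Y$ for $Y\in\mathcal H_t$, are subadditive, satisfy $\mathcal E_t(\lambda Y)=\lambda^+\mathcal E_t(Y)+\lambda^-\mathcal E_t(-Y)$ for $\lambda\in\mathcal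 H_t$, and $\mathcal E_0(X_i)\to0$ whenever $X_i\downarrow0$ pointwise); $\mathcal E:=\mathcal E_0$. "Quasi-surely" (q.s.) means outside a set $N$ with $\mathcal E(I_N)=0$. Independence: $Y\in\mathcal H$ is independent of $Z=(Z_1,\dots,Z_k)$ under $\mathcal E$ if for every measurable $\varphi$ with $\varphi(Z,Y)\in\mathcal H$ and $\varphi(z,Y)\in\mathcal H$ for all $z$, $\mathcal E[\varphi(Z,Y)]=\mathcal E[\bar\varphi(Z)]$ with $\bar\varphi(z):=\mathcal E[\varphi(z,Y)]$; $X$ is independent of $\mathcal F_n$ if $X$ is independent of $I_A$ for every $A\in\mathcal F_n$. $L^1_b$: the completion of bounded elements of $\mathcal H$ under $\mathcal E(|\cdot|)$, equivalently the $X\in L^1$ with $\lim_n\mathcal E(|X|I_{\{|X|>n\}})=0$. *)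

theory Defs
  imports "HOL-Analysis.Analysis"
begin

definition filtration_on :: "(nat \<Rightarrow> 'a set set) \<Rightarrow> bool" where
  "filtration_on F \<longleftrightarrow> (\<forall>t. sigma_algebra UNIV (F t)) \<and> (\<forall>s t. s \<le> t \<longrightarrow> F s \<subseteq> F t)
     \<and> F 0 = {{}, UNIV}"

definition Finf :: "(nat \<Rightarrow> 'a set set) \<Rightarrow> 'a set set" where
  "Finf F = sigma_sets UNIV (\<Union>t. F t)"

definition meas_wrt :: "'a set set \<Rightarrow> ('a \<Rightarrow> real) \<Rightarrow> bool" where
  "meas_wrt S X \<longleftrightarrow> (\<forall>B \<in> sets borel. X -` B \<in> S)"

definition rv_space :: "(nat \<Rightarrow> 'a set set) \<Rightarrow> ('a \<Rightarrow> real) set \<Rightarrow> bool" where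
  "rv_space F H \<longleftrightarrow>
     (\<forall>X\<in>H. meas_wrt (Finf F) X) \<and>
     (\<forall>c. (\<lambda>_. c) \<in> H) \<and>
     (\<forall>X\<in>H. \<forall>Y\<in>H. (\<lambda>\<omega>. X \<omega> + Y \<omega>) \<in> H) \<and>
     (\<forall>X\<in>H. \<forall>c::real. (\<lambda>\<omega>. c * X \<omega>) \<in> H) \<and>
     (\<forall>X\<in>H. (\<lambda>\<omega>. \<bar>X \<omega>\<bar>) \<in> H) \<and>
     (\<forall>X\<in>H. \<forall>A\<in>Finf F. (\<lambda>\<omega>. indicator A \<omega> * X \<omega>) \<in> H)"

definition Hsub :: "(nat \<Rightarrow> 'a set set) \<Rightarrow> ('a \<Rightarrow> real) set \<Rightarrow> nat \<Rightarrow> ('a \<Rightarrow> real) set" where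
  "Hsub F H t = {X \<in> H. meas_wrt (F t) X}"

definition SL_expectation ::
  "(nat \<Rightarrow> 'a set set) \<Rightarrow> ('a \<Rightarrow> real) set \<Rightarrow> (nat \<Rightarrow> ('a \<Rightarrow> real) \<Rightarrow> ('a \<Rightarrow> real)) \<Rightarrow> bool" where
  "SL_expectation F H E \<longleftrightarrow>
     (\<forall>t. \<forall>X\<in>H. E t X \<in> Hsub F H t) \<and>
     (\<forall>t. \<forall>X\<in>H. \<forall>Y\<in>H. (\<forall>\<omega>. X \<omega> \<le> Y \<omega>) \<longrightarrow> (\<forall>\<omega>. E t X \<omega> \<le> E t Y \<omega>)) \<and>
     (\<forall>s t. \<forall>X\<in>H. s \<le> t \<longrightarrow> E s (E t X) = E s X) \<and>
     (\<forall>t. \<forall>A\<in>F t. \<forall>Y\<in>H. E t (\<lambda>\<omega>. indicator A \<omega> * Y \<omega>) = (\<lambda>\<omega>. indicator A \<omega> * E t Y \<omega>)) \<and>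
     (\<forall>t. \<forall>Y\<in>Hsub F H t. E t Y = Y) \<and>
     (\<forall>t. \<forall>X\<in>H. \<forall>Y\<in>H. \<forall>\<omega>. E t (\<lambda>\<omega>'. X \<omega>' + Y \<omega>') \<omega> \<le> E t X \<omega> + E t Y \<omega>) \<and>
     (\<forall>t. \<forall>l\<in>Hsub F H t. \<forall>Y\<in>H. (\<lambda>\<omega>. l \<omega> * Y \<omega>) \<in> H \<longrightarrow>
        E t (\<lambda>\<omega>. l \<omega> * Y \<omega>) =
          (\<lambda>\<omega>. max (l \<omega>) 0 * E t Y \<omega> + max (- l \<omega>) 0 * E t (\<lambda>\<omega>'. - Y \<omega>') \<omega>)) \<and>
     (\<forall>Xs::nat \<Rightarrow> 'a \<Rightarrow> real. (\<forall>i. Xs i \<in> H) \<and> (\<forall>i \<omega>. Xs (Suc i) \<omega> \<le> Xs i \<omega>) \<and>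
        (\<forall>\<omega>. (\<lambda>i. Xs i \<omega>) \<longlonglongrightarrow> 0) \<longrightarrow> (\<forall>\<omega>. (\<lambda>i. E 0 (Xs i) \<omega>) \<longlonglongrightarrow> 0))"

text \<open>The scalar expectation: E 0 X is constant (F 0 trivial); take its value at any point.\<close>
definition Ex0 :: "(nat \<Rightarrow> ('a \<Rightarrow> real) \<Rightarrow> ('a \<Rightarrow> real)) \<Rightarrow> ('a \<Rightarrow> real) \<Rightarrow> real" where
  "Ex0 E X = E 0 X (SOME \<omega>. True)"

definition quasi_surely ::
  "(nat \<Rightarrow> 'a set set) \<Rightarrow> (nat \<Rightarrow> ('a \<Rightarrow> real) \<Rightarrow> ('a \<Rightarrow> real)) \<Rightarrow> ('a \<Rightarrow> bool) \<Rightarrow> bool" where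
  "quasi_surely F E P \<longleftrightarrow>
     (\<exists>N \<in> Finf F. Ex0 E (indicator N) = 0 \<and> (\<forall>\<omega>. \<omega> \<notin> N \<longrightarrow> P \<omega>))"

definition indep_of ::
  "('a \<Rightarrow> real) set \<Rightarrow> (nat \<Rightarrow> ('a \<Rightarrow> real) \<Rightarrow> ('a \<Rightarrow> real)) \<Rightarrow> ('a \<Rightarrow> real) \<Rightarrow> ('a \<Rightarrow> real) \<Rightarrow> bool" where
  "indep_of H E Y Z \<longleftrightarrow>
     (\<forall>\<phi>::real \<Rightarrow> real \<Rightarrow> real. case_prod \<phi> \<in> borel_measurable borel \<longrightarrow>
        (\<lambda>\<omega>. \<phi> (Z \<omega>) (Y \<omega>)) \<in> H \<longrightarrow> (\<forall>z. (\<lambda>\<omega>. \<phi> z (Y \<omega>)) \<in> H) \<longrightarrow>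
        Ex0 E (\<lambda>\<omega>. \<phi> (Z \<omega>) (Y \<omega>)) = Ex0 E (\<lambda>\<omega>. Ex0 E (\<lambda>\<omega>'. \<phi> (Z \<omega>) (Y \<omega>'))))"

definition indep_of_sigma ::
  "(nat \<Rightarrow> 'a set set) \<Rightarrow> ('a \<Rightarrow> real) set \<Rightarrow> (nat \<Rightarrow> ('a \<Rightarrow> real) \<Rightarrow> ('a \<Rightarrow> real)) \<Rightarrow> ('a \<Rightarrow> real) \<Rightarrow> nat \<Rightarrow> bool" where
  "indep_of_sigma F H E X n \<longleftrightarrow> (\<forall>A \<in> F n. indep_of H E X (indicator A))"

text \<open>L^1_b membership (for X in H), via the uniform-integrability characterization.\<close>
definition L1b :: "('a \<Rightarrow> real) set \<Rightarrow> (nat \<Rightarrow> ('a \<Rightarrow> real) \<Rightarrow> ('a \<Rightarrow> real)) \<Rightarrow> ('a \<Rightarrow> real) \<Rightarrow> bool" where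
  "L1b H E X \<longleftrightarrow> X \<in> H \<and>
     (\<lambda>n::nat. Ex0 E (\<lambda>\<omega>. \<bar>X \<omega>\<bar> * indicator {\<omega>'. \<bar>X \<omega>'\<bar> > real n} \<omega>)) \<longlonglongrightarrow> 0"

end

theory Submission
  imports Defs
begin

text \<open>
  By Kronecker's lemma it suffices that the series of \<open>W n = (X n - E (X n)) / b n\<close> converges
  quasi-surely. Since \<open>H\<close> need not be closed under products, \<open>W n\<close> is first replaced by a centred
  function \<open>Y n\<close> of \<open>W n\<close> with finitely many values, with summable error. The upper means of the \<open>Y n\<close>
  vanish, but their lower means \<open>- \<delta> n\<close> need not. The crucial point is that nevertheless the sum of the
  \<open>\<delta> n\<close> is finite: otherwise one can choose consecutive blocks on each of which the \<open>\<delta> n\<close> add up to at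
  least 1 while the variances are negligible. By independence, the expectation may use lower means
  on block \<open>n\<close> and upper means on all later blocks, so the event that block \<open>n\<close> is the last one with a
  block sum below \<open>- 1/2\<close> has capacity at least \<open>1/2\<close>. These events are disjoint, which contradicts
  the continuity of \<open>E\<close> along decreasing sequences with limit 0. Once the \<open>\<delta> n\<close> and the variances are
  both summable, stopping the partial sums gives a Kolmogorov type maximal inequality.
\<close>

section \<open>Sublinear expectations: measurability and the space \<open>H\<close>\<close>

locale sublinear_expectation =
  fixes F :: "nat \<Rightarrow> 'a set set"
    and H :: "('a \<Rightarrow> real) set"
    and E :: "nat \<Rightarrow> ('a \<Rightarrow> real) \<Rightarrow> ('a \<Rightarrow> real)"
  assumes filt: "filtration_on F"
    and rv: "rv_space F H"
    and SL: "SL_expectation F H E"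
begin

abbreviation e :: "('a \<Rightarrow> real) \<Rightarrow> real" where "e \<equiv> Ex0 E"

abbreviation cap :: "'a set \<Rightarrow> real" where "cap A \<equiv> Ex0 E (indicator A)"

abbreviation qs :: "('a \<Rightarrow> bool) \<Rightarrow> bool" where "qs \<equiv> quasi_surely F E"

text \<open>Packaging the sigma-algebras as \<open>measure\<close> objects gives access to
  \<open>borel_measurable\<close> and \<open>simple_function\<close>; only their measurable sets
  matter, never a measure on them.\<close>

definition MF :: "nat \<Rightarrow> 'a measure" where "MF t = sigma UNIV (F t)"

definition Minf :: "'a measure" where "Minf = sigma UNIV (Finf F)"

lemma space_MF [simp]: "space (MF t) = UNIV"
  by (simp add: MF_def)

lemma space_Minf [simp]: "space Minf = UNIV"
  by (simp add: Minf_def)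

lemma sets_MF [simp]: "sets (MF t) = F t"
proof -
  have "sigma_algebra UNIV (F t)" using filt by (simp add: filtration_on_def)
  then show ?thesis
    by (simp add: MF_def sigma_algebra.sets_measure_of_eq sigma_algebra.sigma_sets_eq)
qed

lemma sets_Minf [simp]: "sets Minf = Finf F"
proof -
  have "sigma_algebra UNIV (Finf F)" unfolding Finf_def
    by (rule sigma_algebra_sigma_sets) simp
  then show ?thesis
    by (simp add: Minf_def sigma_algebra.sets_measure_of_eq sigma_algebra.sigma_sets_eq)
qed

lemma F_subset_Finf: "F t \<subseteq> Finf F"
  unfolding Finf_def by auto

lemma F_mono: "s \<le> t \<Longrightarrow> F s \<subseteq> F t"
  using filt by (simp add: filtration_on_def)

lemma simple_MF_mono:
  assumes "s \<le> t" "simple_function (MF s) X" shows "simple_function (MF t) X"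
  using assms F_mono[of s t] by (auto simp: simple_function_def)

lemma simple_MF_Minf:
  assumes "simple_function (MF s) X" shows "simple_function Minf X"
  using assms F_subset_Finf[of s] by (auto simp: simple_function_def)

lemma meas_wrt_MF: "meas_wrt (F t) X \<longleftrightarrow> X \<in> borel_measurable (MF t)"
  by (auto simp: meas_wrt_def measurable_def)

lemma meas_wrt_Minf: "meas_wrt (Finf F) X \<longleftrightarrow> X \<in> borel_measurable Minf"
  by (auto simp: meas_wrt_def measurable_def)

lemma Hsub_iff: "X \<in> Hsub F H t \<longleftrightarrow> X \<in> H \<and> X \<in> borel_measurable (MF t)"
  by (simp add: Hsub_def meas_wrt_MF)

lemma H_measurable [measurable_dest]: "X \<in> H \<Longrightarrow> X \<in> borel_measurable Minf"
  using rv by (simp add: rv_space_def meas_wrt_Minf)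

lemma H_const [simp, intro]: "(\<lambda>_. c) \<in> H"
  using rv by (simp add: rv_space_def)

lemma H_add [intro]: "X \<in> H \<Longrightarrow> Y \<in> H \<Longrightarrow> (\<lambda>\<omega>. X \<omega> + Y \<omega>) \<in> H"
  using rv by (simp add: rv_space_def)

lemma H_scale [intro]: "X \<in> H \<Longrightarrow> (\<lambda>\<omega>. c * X \<omega>) \<in> H" for c :: real
  using rv by (simp add: rv_space_def)

lemma H_abs [intro]: "X \<in> H \<Longrightarrow> (\<lambda>\<omega>. \<bar>X \<omega>\<bar>) \<in> H"
  using rv by (simp add: rv_space_def)

lemma H_indicator_mult [intro]: "X \<in> H \<Longrightarrow> A \<in> Finf F \<Longrightarrow> (\<lambda>\<omega>. indicator A \<omega> * X \<omega>) \<in> H"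
  using rv by (simp add: rv_space_def)

lemma H_indicator [intro]: "A \<in> Finf F \<Longrightarrow> indicator A \<in> H"
  using H_indicator_mult[OF H_const[of 1], of A] by simp

lemma H_uminus [intro]: "X \<in> H \<Longrightarrow> (\<lambda>\<omega>. - X \<omega>) \<in> H"
  using H_scale[of X "-1"] by simp

lemma H_diff [intro]: "X \<in> H \<Longrightarrow> Y \<in> H \<Longrightarrow> (\<lambda>\<omega>. X \<omega> - Y \<omega>) \<in> H"
  using H_add[OF _ H_uminus, of X Y] by simp

lemma H_sum [intro]: "(\<And>i. i \<in> I \<Longrightarrow> X i \<in> H) \<Longrightarrow> (\<lambda>\<omega>. \<Sum>i\<in>I. X i \<omega>) \<in> H"
  by (induction I rule: infinite_finite_induct) auto

text \<open>A function with finitely many values is a linear combination of indicators. This is the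
  main source of membership in \<open>H\<close> below: squares and products of simple functions are
  again simple, whereas \<open>H\<close> itself need not be closed under products.\<close>

lemma simple_in_H:
  assumes "simple_function Minf X" shows "X \<in> H"
proof -
  have fin: "finite (range X)" and pre: "\<And>y. X -` {y} \<in> Finf F"
    using assms by (auto simp: simple_function_def)
      (metis (no_types, lifting) image_iff rangeI sets_Minf sets.empty_sets vimage_empty
        vimage_singleton_eq subsetI subset_empty equals0I)
  have "(\<Sum>y\<in>range X. y * indicator (X -` {y}) \<omega>) = X \<omega>" for \<omega>
  proof -
    have "(\<Sum>y\<in>range X. y * indicator (X -` {y}) \<omega>) = (\<Sum>y\<in>range X. if y = X \<omega> then y else 0)"
      by (intro sum.cong refl) (auto simp: indicator_def)
    then show ?thesis using fin by simp
  qed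
  moreover have "(\<lambda>\<omega>. \<Sum>y\<in>range X. y * indicator (X -` {y}) \<omega>) \<in> H"
    using pre by (intro H_sum H_scale H_indicator)
  ultimately show ?thesis by simp
qed

lemma simple_in_Hsub:
  assumes "simple_function (MF t) X" shows "X \<in> Hsub F H t"
  using simple_in_H[OF simple_MF_Minf[OF assms]] borel_measurable_simple_function[OF assms]
  by (simp add: Hsub_iff)

section \<open>Conditional and scalar upper expectations\<close>

lemma E_Hsub: "X \<in> H \<Longrightarrow> E t X \<in> Hsub F H t"
  using SL by (simp add: SL_expectation_def)

lemma E_H [intro]: "X \<in> H \<Longrightarrow> E t X \<in> H"
  using E_Hsub by (simp add: Hsub_iff)

lemma E_measurable: "X \<in> H \<Longrightarrow> E t X \<in> borel_measurable (MF t)"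
  using E_Hsub by (simp add: Hsub_iff)

lemma E_mono: "X \<in> H \<Longrightarrow> Y \<in> H \<Longrightarrow> (\<And>\<omega>. X \<omega> \<le> Y \<omega>) \<Longrightarrow> E t X \<omega> \<le> E t Y \<omega>"
  using SL by (simp add: SL_expectation_def)

lemma E_tower: "s \<le> t \<Longrightarrow> X \<in> H \<Longrightarrow> E s (E t X) = E s X"
  using SL by (simp add: SL_expectation_def)

lemma E_indicator_mult:
  "A \<in> F t \<Longrightarrow> X \<in> H \<Longrightarrow> E t (\<lambda>\<omega>. indicator A \<omega> * X \<omega>) = (\<lambda>\<omega>. indicator A \<omega> * E t X \<omega>)"
  using SL by (simp add: SL_expectation_def)

lemma E_adapted: "X \<in> Hsub F H t \<Longrightarrow> E t X = X"
  using SL by (simp add: SL_expectation_def)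

lemma E_subadd: "X \<in> H \<Longrightarrow> Y \<in> H \<Longrightarrow> E t (\<lambda>\<omega>. X \<omega> + Y \<omega>) \<omega> \<le> E t X \<omega> + E t Y \<omega>"
  using SL by (simp add: SL_expectation_def)

lemma E_mult:
  assumes "l \<in> Hsub F H t" "X \<in> H" "(\<lambda>\<omega>. l \<omega> * X \<omega>) \<in> H"
  shows "E t (\<lambda>\<omega>. l \<omega> * X \<omega>) \<omega> = max (l \<omega>) 0 * E t X \<omega> + max (- l \<omega>) 0 * E t (\<lambda>\<omega>. - X \<omega>) \<omega>"
  using SL assms by (simp add: SL_expectation_def)

lemma E0_tendsto_0:
  "(\<And>i. Xs i \<in> H) \<Longrightarrow> (\<And>i \<omega>. Xs (Suc i) \<omega> \<le> Xs i \<omega>) \<Longrightarrow> (\<And>\<omega>. (\<lambda>i. Xs i \<omega>) \<longlonglongrightarrow> 0)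
    \<Longrightarrow> (\<lambda>i. E 0 (Xs i) \<omega>) \<longlonglongrightarrow> 0"
  using SL by (simp add: SL_expectation_def)

lemma Hsub_const [simp]: "(\<lambda>_. c) \<in> Hsub F H t"
  by (simp add: Hsub_iff)

lemma Hsub_uminus: "X \<in> Hsub F H t \<Longrightarrow> (\<lambda>\<omega>. - X \<omega>) \<in> Hsub F H t"
  by (auto simp: Hsub_iff)

text \<open>Adapted summands pull out exactly although \<open>E\<close> is only subadditive: the
  second inequality comes from subadditivity applied to
  \<open>(\<xi> + \<zeta>) + (- \<xi>)\<close>.\<close>

lemma E_adapted_add:
  assumes "\<xi> \<in> Hsub F H t" "\<zeta> \<in> H"
  shows "E t (\<lambda>\<omega>. \<xi> \<omega> + \<zeta> \<omega>) \<omega> = \<xi> \<omega> + E t \<zeta> \<omega>"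
proof (rule antisym)
  have \<xi>: "\<xi> \<in> H" using assms by (simp add: Hsub_iff)
  show "E t (\<lambda>\<omega>. \<xi> \<omega> + \<zeta> \<omega>) \<omega> \<le> \<xi> \<omega> + E t \<zeta> \<omega>"
    using E_subadd[OF \<xi> assms(2), of t \<omega>] E_adapted[OF assms(1)] by simp
  have "E t (\<lambda>\<omega>. (\<xi> \<omega> + \<zeta> \<omega>) + - \<xi> \<omega>) \<omega> \<le> E t (\<lambda>\<omega>. \<xi> \<omega> + \<zeta> \<omega>) \<omega> + E t (\<lambda>\<omega>. - \<xi> \<omega>) \<omega>"
    using \<xi> assms by (intro E_subadd) auto
  then show "\<xi> \<omega> + E t \<zeta> \<omega> \<le> E t (\<lambda>\<omega>. \<xi> \<omega> + \<zeta> \<omega>) \<omega>"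
    using E_adapted[OF Hsub_uminus[OF assms(1)]] by simp
qed

lemma e_mono: "X \<in> H \<Longrightarrow> Y \<in> H \<Longrightarrow> (\<And>\<omega>. X \<omega> \<le> Y \<omega>) \<Longrightarrow> e X \<le> e Y"
  using E_mono[of X Y 0] by (simp add: Ex0_def)

lemma e_tower: "X \<in> H \<Longrightarrow> e (E t X) = e X"
  using E_tower[of 0 t X] by (simp add: Ex0_def)

lemma e_subadd: "X \<in> H \<Longrightarrow> Y \<in> H \<Longrightarrow> e (\<lambda>\<omega>. X \<omega> + Y \<omega>) \<le> e X + e Y"
  using E_subadd[of X Y 0] by (simp add: Ex0_def)

lemma e_const [simp]: "e (\<lambda>_. c) = c"
  using E_adapted[OF Hsub_const, of 0 c] by (simp add: Ex0_def)

lemma e_scale: "X \<in> H \<Longrightarrow> 0 \<le> c \<Longrightarrow> e (\<lambda>\<omega>. c * X \<omega>) = c * e X"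
  using E_mult[where l="\<lambda>_. c" and X=X and t=0] by (auto simp: Ex0_def)

lemma e_add_const: "X \<in> H \<Longrightarrow> e (\<lambda>\<omega>. X \<omega> + c) = e X + c"
  using E_adapted_add[where \<xi>="\<lambda>_. c" and \<zeta>=X and t=0] by (simp add: Ex0_def add.commute)

lemma e_nonneg: "X \<in> H \<Longrightarrow> (\<And>\<omega>. 0 \<le> X \<omega>) \<Longrightarrow> 0 \<le> e X"
  using e_mono[OF H_const[of 0], of X] by simp

lemma e_diff_ge: "X \<in> H \<Longrightarrow> Y \<in> H \<Longrightarrow> e X - e Y \<le> e (\<lambda>\<omega>. X \<omega> - Y \<omega>)"
  using e_subadd[OF H_diff, of X Y Y] by simp

lemma e_uminus_ge: "X \<in> H \<Longrightarrow> - e X \<le> e (\<lambda>\<omega>. - X \<omega>)"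
  using e_subadd[OF H_uminus, of X X] by simp

lemma e_abs_diff: "X \<in> H \<Longrightarrow> Y \<in> H \<Longrightarrow> \<bar>e X - e Y\<bar> \<le> e (\<lambda>\<omega>. \<bar>X \<omega> - Y \<omega>\<bar>)"
proof -
  assume X: "X \<in> H" and Y: "Y \<in> H"
  have "e (\<lambda>\<omega>. X \<omega> - Y \<omega>) \<le> e (\<lambda>\<omega>. \<bar>X \<omega> - Y \<omega>\<bar>)"
    "e (\<lambda>\<omega>. Y \<omega> - X \<omega>) \<le> e (\<lambda>\<omega>. \<bar>X \<omega> - Y \<omega>\<bar>)"
    using X Y by (auto intro!: e_mono)
  then show ?thesis
    using e_diff_ge[OF X Y] e_diff_ge[OF Y X] by simp
qed

lemma e_tendsto_0:
  "(\<And>i. Xs i \<in> H) \<Longrightarrow> (\<And>i \<omega>. Xs (Suc i) \<omega> \<le> Xs i \<omega>) \<Longrightarrow> (\<And>\<omega>. (\<lambda>i. Xs i \<omega>) \<longlonglongrightarrow> 0)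
    \<Longrightarrow> (\<lambda>i. e (Xs i)) \<longlonglongrightarrow> 0"
  using E0_tendsto_0[of Xs] by (simp add: Ex0_def)

text \<open>The tails decrease pointwise to 0, so the downward continuity of \<open>E\<close> makes
  every element of \<open>H\<close> uniformly integrable.\<close>

lemma e_tail_tendsto_0:
  assumes X: "X \<in> H"
  shows "(\<lambda>k. e (\<lambda>\<omega>. indicator {\<omega>. \<bar>X \<omega>\<bar> > real k} \<omega> * \<bar>X \<omega>\<bar>)) \<longlonglongrightarrow> 0"
proof (rule e_tendsto_0)
  have "{\<omega> \<in> space Minf. \<bar>X \<omega>\<bar> > real k} \<in> sets Minf" for k
    using X by measurable
  then show "(\<lambda>\<omega>. indicator {\<omega>. \<bar>X \<omega>\<bar> > real k} \<omega> * \<bar>X \<omega>\<bar>) \<in> H" for k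
    using X by auto
  show "(\<lambda>k. indicator {\<omega>. \<bar>X \<omega>\<bar> > real k} \<omega> * \<bar>X \<omega>\<bar>) \<longlonglongrightarrow> 0" for \<omega>
  proof (rule tendsto_eventually)
    obtain n :: nat where "\<bar>X \<omega>\<bar> \<le> real n" using real_arch_simple by blast
    then show "\<forall>\<^sub>F k in sequentially. indicator {\<omega>. \<bar>X \<omega>\<bar> > real k} \<omega> * \<bar>X \<omega>\<bar> = 0"
      by (intro eventually_sequentiallyI[of n]) (auto simp: indicator_def)
  qed
qed (auto simp: indicator_def)

section \<open>The induced capacity and its continuity\<close>

lemma cap_nonneg: "A \<in> Finf F \<Longrightarrow> 0 \<le> cap A"
  by (intro e_nonneg) auto

lemma cap_mono: "A \<in> Finf F \<Longrightarrow> B \<in> Finf F \<Longrightarrow> A \<subseteq> B \<Longrightarrow> cap A \<le> cap B"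
  by (intro e_mono) (auto simp: indicator_def)

lemma cap_Un: 
  assumes A: "A \<in> Finf F" and B: "B \<in> Finf F" shows "cap (A \<union> B) \<le> cap A + cap B"
proof -
  have AB: "A \<union> B \<in> Finf F" using sets.Un[of A Minf B] A B by simp
  have "cap (A \<union> B) \<le> e (\<lambda>\<omega>. indicator A \<omega> + indicator B \<omega>)"
    using A B AB by (intro e_mono H_add H_indicator) (auto simp: indicator_def)
  also have "\<dots> \<le> cap A + cap B" using A B by (intro e_subadd) auto
  finally show ?thesis .
qed

lemma cap_tendsto_0:
  assumes A: "\<And>i. A i \<in> Finf F" "\<And>i. A (Suc i) \<subseteq> A i" "(\<Inter>i. A i) = {}"
  shows "(\<lambda>i. cap (A i)) \<longlonglongrightarrow> 0"
proof (rule e_tendsto_0)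
  show "(\<lambda>i. indicator (A i) \<omega> :: real) \<longlonglongrightarrow> 0" for \<omega>
  proof -
    obtain n where n: "\<omega> \<notin> A n" using A(3) by blast
    have "decseq A" using A(2) by (rule decseq_SucI)
    then have "\<omega> \<notin> A k" if "n \<le> k" for k
      using n that by (auto dest: decseqD)
    then show ?thesis
      by (intro tendsto_eventually eventually_sequentiallyI[of n]) auto
  qed
  show "indicator (A (Suc i)) \<omega> \<le> (indicator (A i) \<omega> :: real)" for i \<omega>
    using A(2)[of i] by (auto simp: indicator_def)
qed (use A in auto)

text \<open>The sets \<open>U - A i\<close> decrease to the empty set, so subadditivity turns
  continuity at the empty set into continuity from below.\<close>

lemma cap_UN_le:
  assumes A: "\<And>i. A i \<in> Finf F" "\<And>i. A i \<subseteq> A (Suc i)" and le: "\<And>i. cap (A i) \<le> r"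
  shows "cap (\<Union>i. A i) \<le> r"
proof -
  define U where "U = (\<Union>i. A i)"
  have AM: "A i \<in> sets Minf" for i using A by simp
  have UM: "U \<in> sets Minf" unfolding U_def using AM by (intro sets.countable_UN) auto
  have D: "U - A i \<in> Finf F" for i using sets.Diff[OF UM AM[of i]] by simp
  have "(\<lambda>i. cap (U - A i)) \<longlonglongrightarrow> 0"
    using D A(2) by (intro cap_tendsto_0) (auto simp: U_def)
  then have lim: "(\<lambda>i. r + cap (U - A i)) \<longlonglongrightarrow> r + 0" by (intro tendsto_intros)
  have "cap U \<le> r + cap (U - A i)" for i
  proof -
    have "cap U \<le> cap (A i) + cap (U - A i)"
      using cap_Un[OF A(1)[of i] D[of i]] by (simp add: U_def Un_absorb1 UN_upper)
    then show ?thesis using le[of i] by simp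
  qed
  then have "cap U \<le> r + 0" by (intro LIMSEQ_le_const[OF lim]) auto
  then show ?thesis by (simp add: U_def)
qed

text \<open>The sets \<open>A i - U\<close> decrease to the empty set, and by subadditivity
  \<open>cap U\<close> falls short of \<open>cap (A i)\<close> by at most
  \<open>cap (A i - U)\<close>. This later carries lower bounds from finite to infinite time
  horizons.\<close>

lemma cap_INT_ge:
  assumes A: "\<And>i. A i \<in> Finf F" "\<And>i. A (Suc i) \<subseteq> A i" and le: "\<And>i. r \<le> cap (A i)"
  shows "r \<le> cap (\<Inter>i. A i)"
proof -
  define U where "U = (\<Inter>i. A i)"
  have AM: "A i \<in> sets Minf" for i using A by simp
  have UM: "U \<in> sets Minf" unfolding U_def using AM by (intro sets.countable_INT) auto
  have D: "A i - U \<in> Finf F" for i using sets.Diff[OF AM[of i] UM] by simp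
  have "(\<lambda>i. cap (A i - U)) \<longlonglongrightarrow> 0"
    using D A(2) by (intro cap_tendsto_0) (auto simp: U_def)
  then have lim: "(\<lambda>i. cap U + cap (A i - U)) \<longlonglongrightarrow> cap U + 0" by (intro tendsto_intros)
  have "r \<le> cap U + cap (A i - U)" for i
  proof -
    have "U \<union> (A i - U) = A i" by (auto simp: U_def)
    then show ?thesis using le[of i] cap_Un[OF _ D[of i], of U] UM by simp
  qed
  then have "r \<le> cap U + 0" by (intro LIMSEQ_le_const[OF lim]) auto
  then show ?thesis by (simp add: U_def)
qed

lemma cap_UN_null:
  assumes A: "\<And>i::nat. A i \<in> Finf F" "\<And>i. cap (A i) = 0"
  shows "cap (\<Union>i. A i) = 0"
proof -
  have AM: "A i \<in> sets Minf" for i using A by simp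
  have U: "(\<Union>i\<le>n. A i) \<in> Finf F" for n
    using sets.finite_UN[of "{..n}" A Minf] A by auto
  have *: "cap (\<Union>i\<le>n. A i) \<le> 0" for n
  proof (induction n)
    case (Suc n)
    have "(\<Union>i\<le>Suc n. A i) = (\<Union>i\<le>n. A i) \<union> A (Suc n)" by (auto simp: le_Suc_eq)
    then show ?case using cap_Un[OF U[of n] A(1)[of "Suc n"]] Suc A(2) by simp
  qed (use A in simp)
  have "cap (\<Union>n. \<Union>i\<le>n. A i) \<le> 0"
    using U * by (intro cap_UN_le) (auto intro: le_SucI)
  moreover have "(\<Union>n. \<Union>i\<le>n. A i) = (\<Union>i. A i)" by auto
  moreover have "(\<Union>i. A i) \<in> Finf F" using sets.countable_UN[of A UNIV Minf] A by auto
  ultimately show ?thesis using cap_nonneg[of "\<Union>i. A i"] by simp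
qed

section \<open>Quasi-sure statements and inequalities\<close>

lemma qs_mono: "qs P \<Longrightarrow> (\<And>\<omega>. P \<omega> \<Longrightarrow> Q \<omega>) \<Longrightarrow> qs Q"
  unfolding quasi_surely_def by blast

lemma qs_all:
  assumes "\<And>i::nat. qs (P i)" shows "qs (\<lambda>\<omega>. \<forall>i. P i \<omega>)"
proof -
  obtain N where N: "\<And>i. N i \<in> Finf F" "\<And>i. cap (N i) = 0" "\<And>i \<omega>. \<omega> \<notin> N i \<Longrightarrow> P i \<omega>"
    using assms unfolding quasi_surely_def by metis
  show ?thesis unfolding quasi_surely_def
  proof (intro bexI conjI)
    show "cap (\<Union>i. N i) = 0" using N by (intro cap_UN_null) auto
    show "(\<Union>i. N i) \<in> Finf F" using sets.countable_UN[of N UNIV Minf] N by auto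
  qed (use N in auto)
qed

lemma qs_conj:
  assumes "qs P" "qs Q" shows "qs (\<lambda>\<omega>. P \<omega> \<and> Q \<omega>)"
proof -
  have "qs (\<lambda>\<omega>. \<forall>i::nat. if i = 0 then P \<omega> else Q \<omega>)"
  proof (rule qs_all)
    show "qs (\<lambda>\<omega>. if i = 0 then P \<omega> else Q \<omega>)" for i :: nat
      using assms by (cases i) auto
  qed
  then show ?thesis by (rule qs_mono) (metis zero_neq_one)
qed

text \<open>On \<open>N\<close> an unbounded \<open>X\<close> is dominated by the constant
  \<open>k\<close> plus its tail beyond \<open>k\<close>. The constant contributes nothing since
  \<open>cap N = 0\<close>, and the tail vanishes as \<open>k\<close> grows.\<close>

lemma e_null:
  assumes X: "X \<in> H" and N: "N \<in> Finf F" "cap N = 0"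
  shows "e (\<lambda>\<omega>. indicator N \<omega> * \<bar>X \<omega>\<bar>) = 0"
proof -
  have tail: "(\<lambda>\<omega>. indicator {\<omega>. \<bar>X \<omega>\<bar> > real k} \<omega> * \<bar>X \<omega>\<bar>) \<in> H" for k
  proof -
    have "{\<omega> \<in> space Minf. \<bar>X \<omega>\<bar> > real k} \<in> sets Minf"
      using X by measurable
    then show ?thesis using X by auto
  qed
  have "e (\<lambda>\<omega>. indicator N \<omega> * \<bar>X \<omega>\<bar>) \<le> e (\<lambda>\<omega>. indicator {\<omega>. \<bar>X \<omega>\<bar> > real k} \<omega> * \<bar>X \<omega>\<bar>)" for k
  proof -
    have "e (\<lambda>\<omega>. indicator N \<omega> * \<bar>X \<omega>\<bar>)
        \<le> e (\<lambda>\<omega>. real k * indicator N \<omega> + indicator {\<omega>. \<bar>X \<omega>\<bar> > real k} \<omega> * \<bar>X \<omega>\<bar>)"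
      using X N tail by (intro e_mono H_add H_scale H_indicator tail H_indicator_mult[of _ N] H_abs) (auto simp: indicator_def)
    also have "\<dots> \<le> e (\<lambda>\<omega>. real k * indicator N \<omega>) + e (\<lambda>\<omega>. indicator {\<omega>. \<bar>X \<omega>\<bar> > real k} \<omega> * \<bar>X \<omega>\<bar>)"
      using X N tail by (intro e_subadd) auto
    also have "e (\<lambda>\<omega>. real k * indicator N \<omega>) = 0"
      using N by (subst e_scale) auto
    finally show ?thesis by simp
  qed
  then have "e (\<lambda>\<omega>. indicator N \<omega> * \<bar>X \<omega>\<bar>) \<le> 0"
    by (intro LIMSEQ_le_const[OF e_tail_tendsto_0[OF X]]) auto
  moreover have "0 \<le> e (\<lambda>\<omega>. indicator N \<omega> * \<bar>X \<omega>\<bar>)"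
    using X N by (intro e_nonneg) auto
  ultimately show ?thesis by simp
qed

text \<open>Adding \<open>\<bar>X - Y\<bar>\<close> to \<open>Y\<close> on the exceptional set makes
  the inequality hold everywhere, and by \<open>e_null\<close> this correction costs
  nothing.\<close>

lemma e_mono_qs:
  assumes X: "X \<in> H" and Y: "Y \<in> H" and le: "qs (\<lambda>\<omega>. X \<omega> \<le> Y \<omega>)"
  shows "e X \<le> e Y"
proof -
  obtain N where N: "N \<in> Finf F" "cap N = 0" "\<And>\<omega>. \<omega> \<notin> N \<Longrightarrow> X \<omega> \<le> Y \<omega>"
    using le unfolding quasi_surely_def by blast
  have XY: "(\<lambda>\<omega>. X \<omega> - Y \<omega>) \<in> H" using X Y by auto
  have "e X \<le> e (\<lambda>\<omega>. Y \<omega> + indicator N \<omega> * \<bar>X \<omega> - Y \<omega>\<bar>)"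
    using X Y N XY
    by (intro e_mono H_add H_indicator_mult H_abs) (fastforce simp: indicator_def)+
  also have "\<dots> \<le> e Y + e (\<lambda>\<omega>. indicator N \<omega> * \<bar>X \<omega> - Y \<omega>\<bar>)"
    using X Y N XY by (intro e_subadd H_add H_indicator_mult H_abs) 
  finally show ?thesis using e_null[OF XY N(1,2)] by simp
qed

text \<open>The one-step estimate for inductions over time: conditioning at time \<open>t\<close>
  pulls out \<open>\<xi>\<close> and leaves the conditional mean of \<open>\<zeta>\<close>, which is
  bounded quasi-surely.\<close>

lemma e_add_le_qs:
  assumes \<xi>: "\<xi> \<in> Hsub F H t" and \<zeta>: "\<zeta> \<in> H" and le: "qs (\<lambda>\<omega>. E t \<zeta> \<omega> \<le> r)"
  shows "e (\<lambda>\<omega>. \<xi> \<omega> + \<zeta> \<omega>) \<le> e \<xi> + r"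
proof -
  have \<xi>H: "\<xi> \<in> H" using \<xi> by (simp add: Hsub_iff)
  have "e (\<lambda>\<omega>. \<xi> \<omega> + \<zeta> \<omega>) = e (\<lambda>\<omega>. \<xi> \<omega> + E t \<zeta> \<omega>)"
    using e_tower[OF H_add[OF \<xi>H \<zeta>], of t] E_adapted_add[OF \<xi> \<zeta>, abs_def] by simp
  also have "\<dots> \<le> e (\<lambda>\<omega>. \<xi> \<omega> + r)"
    using \<xi>H \<zeta> by (intro e_mono_qs H_add qs_mono[OF le]) auto
  finally show ?thesis using e_add_const[OF \<xi>H] by simp
qed

lemma e_add_ge_qs:
  assumes \<xi>: "\<xi> \<in> Hsub F H t" and \<zeta>: "\<zeta> \<in> H" and le: "qs (\<lambda>\<omega>. r \<le> E t \<zeta> \<omega>)"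
  shows "e \<xi> + r \<le> e (\<lambda>\<omega>. \<xi> \<omega> + \<zeta> \<omega>)"
proof -
  have \<xi>H: "\<xi> \<in> H" using \<xi> by (simp add: Hsub_iff)
  have "e (\<lambda>\<omega>. \<xi> \<omega> + r) \<le> e (\<lambda>\<omega>. \<xi> \<omega> + E t \<zeta> \<omega>)"
    using \<xi>H \<zeta> by (intro e_mono_qs H_add qs_mono[OF le]) auto
  also have "\<dots> = e (\<lambda>\<omega>. \<xi> \<omega> + \<zeta> \<omega>)"
    using e_tower[OF H_add[OF \<xi>H \<zeta>], of t] E_adapted_add[OF \<xi> \<zeta>, abs_def] by simp
  finally show ?thesis using e_add_const[OF \<xi>H] by simp
qed

lemma markov:
  assumes X: "X \<in> H" "\<And>\<omega>. 0 \<le> X \<omega>" and c: "0 < c"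
  shows "{\<omega>. c \<le> X \<omega>} \<in> Finf F" "cap {\<omega>. c \<le> X \<omega>} \<le> e X / c"
proof -
  have "{\<omega> \<in> space Minf. c \<le> X \<omega>} \<in> sets Minf"
    using X by measurable
  then show S: "{\<omega>. c \<le> X \<omega>} \<in> Finf F" by simp
  have "cap {\<omega>. c \<le> X \<omega>} \<le> e (\<lambda>\<omega>. (1/c) * X \<omega>)"
    using X c S by (intro e_mono H_indicator H_scale) (auto simp: indicator_def field_simps)
  also have "\<dots> = e X / c" using X c by (subst e_scale) auto
  finally show "cap {\<omega>. c \<le> X \<omega>} \<le> e X / c" .
qed

text \<open>The intersection of all \<open>B m\<close> has capacity at most \<open>r m\<close> for
  every \<open>m\<close>, hence capacity 0.\<close>

lemma qs_notin_all:
  assumes B: "\<And>m. B m \<in> Finf F" and le: "\<And>m. cap (B m) \<le> r m" and r: "r \<longlonglongrightarrow> 0"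
  shows "qs (\<lambda>\<omega>. \<exists>m. \<omega> \<notin> B m)"
proof -
  have I: "(\<Inter>m. B m) \<in> Finf F" using sets.countable_INT[of B UNIV Minf] B by auto
  have "cap (\<Inter>m. B m) \<le> r m" for m
    using cap_mono[OF I B[of m]] le[of m] by (auto intro: order_trans)
  then have "cap (\<Inter>m. B m) \<le> 0" by (intro LIMSEQ_le_const[OF r]) auto
  then have "cap (\<Inter>m. B m) = 0" using cap_nonneg[OF I] by simp
  then show ?thesis unfolding quasi_surely_def using I by blast
qed

section \<open>From independence to conditional expectations\<close>

lemma indep_indicator:
  assumes ind: "indep_of_sigma F H E X t" and A: "A \<in> F t"
    and f: "f \<in> borel_measurable borel" and fX: "(\<lambda>\<omega>. f (X \<omega>)) \<in> H"
  shows "e (\<lambda>\<omega>. indicator A \<omega> * f (X \<omega>)) = e (\<lambda>\<omega>. indicator A \<omega> * e (\<lambda>\<omega>. f (X \<omega>)))"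
proof -
  \<comment> \<open>The first argument will be an indicator, which is nonnegative, so positive
    homogeneity evaluates the inner expectation.\<close>
  define \<phi> :: "real \<Rightarrow> real \<Rightarrow> real" where "\<phi> = (\<lambda>z y. z * f y)"
  have "(\<lambda>p. fst p * f (snd p)) \<in> borel_measurable (borel \<Otimes>\<^sub>M borel)"
    using f by measurable
  then have "case_prod \<phi> \<in> borel_measurable borel"
    by (simp add: \<phi>_def borel_prod case_prod_beta')
  moreover have "(\<lambda>\<omega>. \<phi> (indicator A \<omega>) (X \<omega>)) \<in> H"
    unfolding \<phi>_def using fX A F_subset_Finf by (intro H_indicator_mult) auto
  moreover have "\<forall>z. (\<lambda>\<omega>. \<phi> z (X \<omega>)) \<in> H"
    unfolding \<phi>_def using fX by auto
  ultimately have *: "e (\<lambda>\<omega>. \<phi> (indicator A \<omega>) (X \<omega>))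
      = e (\<lambda>\<omega>. e (\<lambda>\<omega>'. \<phi> (indicator A \<omega>) (X \<omega>')))"
    using ind A unfolding indep_of_sigma_def indep_of_def by blast
  have "e (\<lambda>\<omega>'. \<phi> (indicator A \<omega>) (X \<omega>')) = indicator A \<omega> * e (\<lambda>\<omega>. f (X \<omega>))" for \<omega>
    unfolding \<phi>_def using fX by (intro e_scale) auto
  with * show ?thesis by (simp add: \<phi>_def)
qed

text \<open>Independence is stated for scalar expectations only. Testing it on the
  \<open>F t\<close>-measurable sets where the conditional mean deviates from the constant
  \<open>c\<close> by at least \<open>\<eta>\<close> forces those sets to have capacity 0; countably
  many \<open>\<eta>\<close> suffice.\<close>

lemma indep_E:
  assumes ind: "indep_of_sigma F H E X t"
    and f: "f \<in> borel_measurable borel" and fX: "(\<lambda>\<omega>. f (X \<omega>)) \<in> H"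
  shows "qs (\<lambda>\<omega>. E t (\<lambda>\<omega>. f (X \<omega>)) \<omega> = e (\<lambda>\<omega>. f (X \<omega>)))"
proof -
  define c where "c = e (\<lambda>\<omega>. f (X \<omega>))"
  define Y where "Y = E t (\<lambda>\<omega>. f (X \<omega>))"
  have YH: "Y \<in> H" and Ym: "Y \<in> borel_measurable (MF t)"
    unfolding Y_def using fX E_measurable by auto
  \<comment> \<open>Normalising the mean to 1 makes \<open>e (indicator A * mean)\<close> equal to the capacity of \<open>A\<close>.\<close>
  have key: "cap A = e (\<lambda>\<omega>. indicator A \<omega> * (Y \<omega> + (1 - c)))" if A: "A \<in> F t" for A
  proof -
    let ?g = "\<lambda>x. f x + (1 - c)"
    have gX: "(\<lambda>\<omega>. ?g (X \<omega>)) \<in> H" using fX by auto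
    have AF: "A \<in> Finf F" using A F_subset_Finf by auto
    have g: "?g \<in> borel_measurable borel" using f by measurable
    have "e (\<lambda>\<omega>. ?g (X \<omega>)) = 1" using e_add_const[OF fX] by (simp add: c_def)
    then have "cap A = e (\<lambda>\<omega>. indicator A \<omega> * ?g (X \<omega>))"
      using indep_indicator[OF ind A g gX] by simp
    also have "\<dots> = e (E t (\<lambda>\<omega>. indicator A \<omega> * ?g (X \<omega>)))"
      using gX AF by (subst e_tower) auto
    also have "E t (\<lambda>\<omega>. indicator A \<omega> * ?g (X \<omega>)) = (\<lambda>\<omega>. indicator A \<omega> * (Y \<omega> + (1 - c)))"
      using E_indicator_mult[OF A gX] E_adapted_add[OF Hsub_const fX, of t "1 - c"]
      by (simp add: Y_def add.commute)
    finally show ?thesis .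
  qed
  have "qs (\<lambda>\<omega>. \<bar>Y \<omega> - c\<bar> < 1 / real (Suc k))" for k
  proof -
    define \<eta> where "\<eta> = 1 / real (Suc k)"
    have \<eta>: "0 < \<eta>" by (simp add: \<eta>_def)
    have scale: "e (\<lambda>\<omega>. indicator A \<omega> * r) = r * cap A" if "A \<in> Finf F" "0 \<le> r" for A r
      using e_scale[OF H_indicator[OF that(1)] that(2)] by (simp add: mult.commute)
    define A where "A = {\<omega>. c + \<eta> \<le> Y \<omega>}"
    define B where "B = {\<omega>. Y \<omega> \<le> c - \<eta>}"
    have "{\<omega> \<in> space (MF t). c + \<eta> \<le> Y \<omega>} \<in> sets (MF t)"
      "{\<omega> \<in> space (MF t). Y \<omega> \<le> c - \<eta>} \<in> sets (MF t)"
      using Ym by measurable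
    then have A: "A \<in> F t" and B: "B \<in> F t" by (auto simp: A_def B_def)
    then have AF: "A \<in> Finf F" and BF: "B \<in> Finf F" using F_subset_Finf by auto
    \<comment> \<open>On \<open>A\<close> the integrand in \<open>key\<close> is at least
      \<open>1 + \<eta>\<close>, so \<open>(1 + \<eta>) * cap A\<close> is at most
      \<open>cap A\<close>.\<close>
    have "(1 + \<eta>) * cap A = e (\<lambda>\<omega>. indicator A \<omega> * (1 + \<eta>))"
      using scale[OF AF] \<eta> by simp
    also have "\<dots> \<le> e (\<lambda>\<omega>. indicator A \<omega> * (Y \<omega> + (1 - c)))"
      using AF YH by (intro e_mono H_indicator_mult H_add) (auto simp: indicator_def A_def)
    also have "\<dots> = cap A" using key[OF A] by simp
    finally have "\<eta> * cap A \<le> 0" by (simp add: algebra_simps)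
    then have A0: "cap A = 0"
      using \<eta> cap_nonneg[OF AF] by (simp add: mult_le_0_iff)
    have "cap B = e (\<lambda>\<omega>. indicator B \<omega> * (Y \<omega> + (1 - c)))" using key[OF B] .
    also have "\<dots> \<le> e (\<lambda>\<omega>. indicator B \<omega> * (1 - \<eta>))"
      using BF YH by (intro e_mono H_indicator_mult H_add) (auto simp: indicator_def B_def)
    \<comment> \<open>Positive homogeneity is applicable because \<open>\<eta>\<close> is at most
      1.\<close>
    also have "\<dots> = (1 - \<eta>) * cap B"
      using scale[OF BF] by (simp add: \<eta>_def)
    finally have "\<eta> * cap B \<le> 0" by (simp add: algebra_simps)
    then have B0: "cap B = 0"
      using \<eta> cap_nonneg[OF BF] by (simp add: mult_le_0_iff)
    have "A \<union> B \<in> Finf F" using sets.Un[of A Minf B] AF BF by simp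
    moreover have "cap (A \<union> B) = 0"
      using cap_Un[OF AF BF] A0 B0 cap_nonneg[OF calculation] by simp
    moreover have "\<bar>Y \<omega> - c\<bar> < \<eta>" if "\<omega> \<notin> A \<union> B" for \<omega>
      using that by (auto simp: A_def B_def)
    ultimately show ?thesis unfolding quasi_surely_def \<eta>_def by blast
  qed
  then have "qs (\<lambda>\<omega>. \<forall>k. \<bar>Y \<omega> - c\<bar> < 1 / real (Suc k))" by (rule qs_all)
  then show ?thesis
  proof (rule qs_mono)
    fix \<omega> assume *: "\<forall>k. \<bar>Y \<omega> - c\<bar> < 1 / real (Suc k)"
    have "\<bar>Y \<omega> - c\<bar> \<le> 0"
      by (rule LIMSEQ_le_const[OF LIMSEQ_Suc[OF lim_1_over_n]]) (use * in \<open>auto intro: less_imp_le\<close>)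
    then show "E t (\<lambda>\<omega>. f (X \<omega>)) \<omega> = e (\<lambda>\<omega>. f (X \<omega>))" by (simp add: Y_def c_def)
  qed
qed


section \<open>Simple functions and second moments of block sums\<close>

lemma E_diff_ge:
  assumes "X \<in> H" "Z \<in> H" shows "E t X \<omega> - E t Z \<omega> \<le> E t (\<lambda>\<omega>. X \<omega> - Z \<omega>) \<omega>"
  using E_subadd[OF H_diff[OF assms] assms(2), of t \<omega>] by simp

lemma simple_square:
  fixes f :: "'b \<Rightarrow> real"
  shows "simple_function M f \<Longrightarrow> simple_function M (\<lambda>\<omega>. (f \<omega>)\<^sup>2)"
  by (rule simple_function_compose1)

lemma simple_set:
  assumes "simple_function (MF t) f" shows "{\<omega>. P (f \<omega>)} \<in> F t"
proof -
  have "{\<omega>. P (f \<omega>)} = f -` {y. P y} \<inter> space (MF t)" by auto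
  then show ?thesis using simple_functionD(2)[OF assms, of "{y. P y}"] by simp
qed

lemma simple_MF_in_H: "simple_function (MF t) X \<Longrightarrow> X \<in> H"
  using simple_in_Hsub by (simp add: Hsub_iff)

lemma simple_block_sum:
  fixes V :: "nat \<Rightarrow> 'a \<Rightarrow> real"
  assumes "\<And>i. simple_function (MF (Suc i)) (V i)"
  shows "simple_function (MF k) (\<lambda>\<omega>. \<Sum>i=m..<k. V i \<omega>)"
proof (intro simple_function_sum)
  fix i assume "i \<in> {m..<k}"
  then show "simple_function (MF k) (V i)"
    using simple_MF_mono[OF _ assms, of i k] by simp
qed

text \<open>The sign condition on the conditional means of both \<open>V i\<close> and \<open>- V i\<close> says that
  any multiple of \<open>V i\<close> by an \<open>F i\<close>-measurable factor has nonnegative upper expectation.\<close>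
lemma e_minus_square_block:
  fixes V :: "nat \<Rightarrow> 'a \<Rightarrow> real"
  assumes V: "\<And>i. simple_function (MF (Suc i)) (V i)"
    and pos: "\<And>i. qs (\<lambda>\<omega>. 0 \<le> E i (V i) \<omega>)"
    and neg: "\<And>i. qs (\<lambda>\<omega>. 0 \<le> E i (\<lambda>\<omega>. - V i \<omega>) \<omega>)"
    and sq: "\<And>i. qs (\<lambda>\<omega>. E i (\<lambda>\<omega>. (V i \<omega>)\<^sup>2) \<omega> \<le> w i)"
    and \<Phi>: "simple_function (MF m) \<Phi>" and "m \<le> k"
  shows "e \<Phi> - (\<Sum>i=m..<k. w i) \<le> e (\<lambda>\<omega>. \<Phi> \<omega> - (\<Sum>i=m..<k. V i \<omega>)\<^sup>2)"
  using \<open>m \<le> k\<close>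
proof (induction k rule: dec_induct)
  case (step k)
  define g where "g = (\<lambda>\<omega>. \<Sum>i=m..<k. V i \<omega>)"
  define \<xi> where "\<xi> = (\<lambda>\<omega>. \<Phi> \<omega> - (g \<omega>)\<^sup>2)"
  \<comment> \<open>Extending the block by \<open>V k\<close> changes minus the square of its sum by
    \<open>l * V k - (V k)^2\<close>. By \<open>E_mult\<close> the cross term has nonnegative upper
    conditional mean whatever the sign of \<open>l\<close>.\<close>
  define l where "l = (\<lambda>\<omega>. -2 * g \<omega>)"
  have g: "simple_function (MF k) g" unfolding g_def by (rule simple_block_sum[OF V])
  then have \<xi>: "simple_function (MF k) \<xi>" and l: "simple_function (MF k) l"
    unfolding \<xi>_def l_def using simple_MF_mono[OF step(1) \<Phi>]
    by (auto intro: simple_square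
        intro!: simple_function_compose[of _ g "\<lambda>x. - (2 * x)", unfolded comp_def])
  have VH: "V k \<in> H" "(\<lambda>\<omega>. (V k \<omega>)\<^sup>2) \<in> H"
    using V[of k] by (auto intro: simple_MF_in_H simple_square)
  have lVH: "(\<lambda>\<omega>. l \<omega> * V k \<omega>) \<in> H"
    using simple_function_mult[OF simple_MF_mono[OF _ l, of "Suc k"] V[of k]]
    by (auto intro: simple_MF_in_H)
  have "qs (\<lambda>\<omega>. - w k \<le> E k (\<lambda>\<omega>. l \<omega> * V k \<omega> - (V k \<omega>)\<^sup>2) \<omega>)"
    using qs_conj[OF qs_conj[OF pos[of k] neg[of k]] sq[of k]]
  proof (rule qs_mono)
    fix \<omega> assume *: "(0 \<le> E k (V k) \<omega> \<and> 0 \<le> E k (\<lambda>\<omega>. - V k \<omega>) \<omega>) \<and> E k (\<lambda>\<omega>. (V k \<omega>)\<^sup>2) \<omega> \<le> w k"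
    have "0 \<le> E k (\<lambda>\<omega>. l \<omega> * V k \<omega>) \<omega>"
      using * E_mult[OF simple_in_Hsub[OF l] VH(1) lVH, of \<omega>] by simp
    then show "- w k \<le> E k (\<lambda>\<omega>. l \<omega> * V k \<omega> - (V k \<omega>)\<^sup>2) \<omega>"
      using * E_diff_ge[OF lVH VH(2), of k \<omega>] by simp
  qed
  then have "e \<xi> + - w k \<le> e (\<lambda>\<omega>. \<xi> \<omega> + (l \<omega> * V k \<omega> - (V k \<omega>)\<^sup>2))"
    using simple_in_Hsub[OF \<xi>] lVH VH by (intro e_add_ge_qs) auto
  also have "(\<lambda>\<omega>. \<xi> \<omega> + (l \<omega> * V k \<omega> - (V k \<omega>)\<^sup>2)) = (\<lambda>\<omega>. \<Phi> \<omega> - (\<Sum>i=m..<Suc k. V i \<omega>)\<^sup>2)"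
    using step(1) by (simp add: fun_eq_iff \<xi>_def l_def g_def power2_eq_square algebra_simps)
  finally show ?case using step by (simp add: \<xi>_def g_def)
qed simp

end

section \<open>Increments with upper mean zero and lower mean \<open>- \<delta> i\<close>\<close>

locale centered_increments = sublinear_expectation +
  fixes Y :: "nat \<Rightarrow> 'a \<Rightarrow> real" and \<delta> v :: "nat \<Rightarrow> real"
  assumes Y_simple: "\<And>i. simple_function (MF (Suc i)) (Y i)"
    and Y_mean: "\<And>i. qs (\<lambda>\<omega>. E i (Y i) \<omega> = 0)"
    and Y_lower_mean: "\<And>i. qs (\<lambda>\<omega>. E i (\<lambda>\<omega>. - Y i \<omega>) \<omega> = \<delta> i)"
    and Y_square: "\<And>i. qs (\<lambda>\<omega>. E i (\<lambda>\<omega>. (Y i \<omega>)\<^sup>2) \<omega> \<le> v i)"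
    and \<delta>_nonneg: "\<And>i. 0 \<le> \<delta> i"
    and \<delta>_le: "\<And>i. (\<delta> i)\<^sup>2 \<le> v i"
    and v_summable: "summable v"
begin

lemma v_nonneg: "0 \<le> v i"
  using \<delta>_le[of i] by (auto intro: order_trans[OF zero_le_power2])

lemma Y_H: "Y i \<in> H"
  by (rule simple_MF_in_H[OF Y_simple])

text \<open>Adding \<open>\<delta> i\<close> makes the lower mean 0 and the upper mean
  \<open>\<delta> i\<close>, so the shifted increments also satisfy the sign conditions of
  \<open>e_minus_square_block\<close>. The cross term has upper mean 0; the factor 4 is
  generous.\<close>

lemma shifted_square:
  "qs (\<lambda>\<omega>. E i (\<lambda>\<omega>. (Y i \<omega> + \<delta> i)\<^sup>2) \<omega> \<le> 4 * v i)"
  using qs_conj[OF Y_mean[of i] Y_square[of i]]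
proof (rule qs_mono)
  fix \<omega> assume *: "E i (Y i) \<omega> = 0 \<and> E i (\<lambda>\<omega>. (Y i \<omega>)\<^sup>2) \<omega> \<le> v i"
  have Y2: "(\<lambda>\<omega>. (Y i \<omega>)\<^sup>2) \<in> H"
    using simple_square[OF Y_simple[of i]] by (rule simple_MF_in_H)
  have "E i (\<lambda>\<omega>. (Y i \<omega> + \<delta> i)\<^sup>2) \<omega> = E i (\<lambda>\<omega>. (\<delta> i)\<^sup>2 + ((Y i \<omega>)\<^sup>2 + 2 * \<delta> i * Y i \<omega>)) \<omega>"
    by (simp add: power2_eq_square algebra_simps)
  also have "\<dots> = (\<delta> i)\<^sup>2 + E i (\<lambda>\<omega>. (Y i \<omega>)\<^sup>2 + 2 * \<delta> i * Y i \<omega>) \<omega>"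
    using Y2 Y_H by (intro E_adapted_add H_add H_scale) auto
  also have "E i (\<lambda>\<omega>. (Y i \<omega>)\<^sup>2 + 2 * \<delta> i * Y i \<omega>) \<omega> \<le> E i (\<lambda>\<omega>. (Y i \<omega>)\<^sup>2) \<omega> + E i (\<lambda>\<omega>. 2 * \<delta> i * Y i \<omega>) \<omega>"
    using Y2 Y_H by (intro E_subadd) auto
  also have "E i (\<lambda>\<omega>. 2 * \<delta> i * Y i \<omega>) \<omega> = 0"
    using E_mult[OF Hsub_const Y_H H_scale[OF Y_H], where t = i] \<delta>_nonneg[of i] * by simp
  finally show "E i (\<lambda>\<omega>. (Y i \<omega> + \<delta> i)\<^sup>2) \<omega> \<le> 4 * v i"
    using * \<delta>_le[of i] v_nonneg[of i] by simp
qed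

lemma shifted_mean: "qs (\<lambda>\<omega>. E i (\<lambda>\<omega>. Y i \<omega> + \<delta> i) \<omega> = \<delta> i)"
  using Y_mean[of i] E_adapted_add[OF Hsub_const Y_H, of i "\<delta> i"]
  by (simp add: add.commute)

lemma shifted_lower_mean: "qs (\<lambda>\<omega>. E i (\<lambda>\<omega>. - (Y i \<omega> + \<delta> i)) \<omega> = 0)"
  using Y_lower_mean[of i] E_adapted_add[OF Hsub_const H_uminus[OF Y_H], of i "- \<delta> i"]
  by (simp add: add.commute)

section \<open>Block sums and summability of the lower means\<close>

definition G :: "(nat \<Rightarrow> nat) \<Rightarrow> nat \<Rightarrow> 'a \<Rightarrow> real" where
  "G kk j \<omega> = (\<Sum>i=kk j..<kk (Suc j). Y i \<omega>)"

text \<open>The threshold lies midway between 0, the centre under upper means, and -1, an upper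
  bound for the centre under lower means once the \<open>\<delta> i\<close> of the block add up to
  at least 1.\<close>

definition low_block :: "(nat \<Rightarrow> nat) \<Rightarrow> nat \<Rightarrow> 'a set" where
  "low_block kk j = {\<omega>. G kk j \<omega> \<le> - (1/2)}"

lemma G_simple: "simple_function (MF (kk (Suc j))) (G kk j)"
  using simple_block_sum[of Y, OF Y_simple] by (simp add: G_def[abs_def])

lemma low_block_sets: "low_block kk j \<in> Finf F"
  using simple_set[OF G_simple[of kk j], of "\<lambda>x. x \<le> -(1/2)"] F_subset_Finf
  by (auto simp: low_block_def)

text \<open>Letting the expectation choose lower means on block \<open>n\<close> and upper means on the later blocks
  makes \<open>G kk n\<close> centred at \<open>- (\<Sum>i=kk n..<kk (Suc n). \<delta> i)\<close> and the later blocks centred at \<open>0\<close>.\<close>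
lemma e_blocks_ge:
  assumes mono: "mono kk"
  shows "1/4 - (\<Sum>i=kk n..<kk (Suc n + N). 4 * v i)
    \<le> e (\<lambda>\<omega>. 1/4 - (G kk n \<omega> + (\<Sum>i=kk n..<kk (Suc n). \<delta> i))\<^sup>2
        - (\<Sum>j=Suc n..<Suc n + N. (G kk j \<omega>)\<^sup>2))"
proof (induction N)
  case 0
  \<comment> \<open>Block \<open>n\<close> alone: with the shifted increments, the square measures
    the distance of the block sum from its centre under lower means.\<close>
  have "e (\<lambda>_. 1/4) - (\<Sum>i=kk n..<kk (Suc n). 4 * v i)
      \<le> e (\<lambda>\<omega>. 1/4 - (\<Sum>i=kk n..<kk (Suc n). Y i \<omega> + \<delta> i)\<^sup>2)"
  proof (rule e_minus_square_block)
    show "simple_function (MF (Suc i)) (\<lambda>\<omega>. Y i \<omega> + \<delta> i)" for i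
      using Y_simple by auto
    show "qs (\<lambda>\<omega>. 0 \<le> E i (\<lambda>\<omega>. Y i \<omega> + \<delta> i) \<omega>)" for i
      by (rule qs_mono[OF shifted_mean[of i]]) (use \<delta>_nonneg in auto)
    show "qs (\<lambda>\<omega>. 0 \<le> E i (\<lambda>\<omega>. - (Y i \<omega> + \<delta> i)) \<omega>)" for i
      by (rule qs_mono[OF shifted_lower_mean[of i]]) auto
    show "kk n \<le> kk (Suc n)" by (rule monoD[OF mono]) simp
  qed (rule shifted_square simple_function_const)+
  then show ?case by (simp add: G_def sum.distrib)
next
  case (Suc N)
  define \<Phi> where "\<Phi> = (\<lambda>\<omega>. 1/4 - (G kk n \<omega> + (\<Sum>i=kk n..<kk (Suc n). \<delta> i))\<^sup>2
        - (\<Sum>j=Suc n..<Suc n + N. (G kk j \<omega>)\<^sup>2))"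
  have G: "simple_function (MF (kk (Suc n + N))) (G kk j)" if "j \<le> n + N" for j
    using that by (intro simple_MF_mono[OF monoD[OF mono] G_simple]) simp
  have \<Phi>: "simple_function (MF (kk (Suc n + N))) \<Phi>"
    unfolding \<Phi>_def
    by (intro simple_function_diff simple_square simple_function_sum simple_function_add G
        simple_function_const) auto
  have le: "kk (Suc n + N) \<le> kk (Suc n + Suc N)" "kk n \<le> kk (Suc n + N)"
    by (rule monoD[OF mono]; simp)+
  have "e \<Phi> - (\<Sum>i=kk (Suc n + N)..<kk (Suc n + Suc N). 4 * v i)
      \<le> e (\<lambda>\<omega>. \<Phi> \<omega> - (\<Sum>i=kk (Suc n + N)..<kk (Suc n + Suc N). Y i \<omega>)\<^sup>2)"
  proof (rule e_minus_square_block[OF Y_simple _ _ _ \<Phi> le(1)])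
    show "qs (\<lambda>\<omega>. 0 \<le> E i (Y i) \<omega>)" for i
      by (rule qs_mono[OF Y_mean[of i]]) auto
    show "qs (\<lambda>\<omega>. 0 \<le> E i (\<lambda>\<omega>. - Y i \<omega>) \<omega>)" for i
      by (rule qs_mono[OF Y_lower_mean[of i]]) (use \<delta>_nonneg in auto)
    \<comment> \<open>The unshifted increments satisfy the bound \<open>v i\<close>; the factor 4
      keeps one form of the error term for all blocks.\<close>
    show "qs (\<lambda>\<omega>. E i (\<lambda>\<omega>. (Y i \<omega>)\<^sup>2) \<omega> \<le> 4 * v i)" for i
      by (rule qs_mono[OF Y_square[of i]]) (use v_nonneg[of i] in auto)
  qed
  also have "(\<lambda>\<omega>. \<Phi> \<omega> - (\<Sum>i=kk (Suc n + N)..<kk (Suc n + Suc N). Y i \<omega>)\<^sup>2)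
     = (\<lambda>\<omega>. 1/4 - (G kk n \<omega> + (\<Sum>i=kk n..<kk (Suc n). \<delta> i))\<^sup>2
        - (\<Sum>j=Suc n..<Suc n + Suc N. (G kk j \<omega>)\<^sup>2))"
    by (simp add: fun_eq_iff \<Phi>_def G_def[of kk "Suc (n + N)"])
  finally have "e \<Phi> - (\<Sum>i=kk (Suc n + N)..<kk (Suc n + Suc N). 4 * v i) 
      \<le> e (\<lambda>\<omega>. 1/4 - (G kk n \<omega> + (\<Sum>i=kk n..<kk (Suc n). \<delta> i))\<^sup>2
        - (\<Sum>j=Suc n..<Suc n + Suc N. (G kk j \<omega>)\<^sup>2))" .
  moreover have "(\<Sum>i=kk n..<kk (Suc n + Suc N). 4 * v i)
    = (\<Sum>i=kk n..<kk (Suc n + N). 4 * v i) + (\<Sum>i=kk (Suc n + N)..<kk (Suc n + Suc N). 4 * v i)"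
    using le by (simp add: sum.atLeastLessThan_concat)
  ultimately show ?case using Suc.IH[folded \<Phi>_def] by linarith
qed

definition last_low :: "(nat \<Rightarrow> nat) \<Rightarrow> nat \<Rightarrow> 'a set" where
  "last_low kk n = {\<omega>. \<omega> \<in> low_block kk n \<and> (\<forall>j>n. \<omega> \<notin> low_block kk j)}"

lemma last_low_disjoint: "n < k \<Longrightarrow> \<omega> \<in> last_low kk n \<Longrightarrow> \<omega> \<notin> last_low kk k"
  by (auto simp: last_low_def)

text \<open>The quadratic expression of \<open>e_blocks_ge\<close> is a pointwise minorant of
  \<open>1/4\<close> times the indicator of the event up to a finite horizon. Its expectation is at
  least \<open>1/8\<close>, so that event has capacity at least \<open>1/2\<close>, and
  \<open>cap_INT_ge\<close> removes the horizon.\<close>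

lemma cap_last_low:
  assumes mono: "mono kk"
    and \<delta>: "1 \<le> (\<Sum>i=kk n..<kk (Suc n). \<delta> i)"
    and v: "\<And>k. (\<Sum>i=kk n..<k. v i) \<le> 1/32"
  shows "last_low kk n \<in> Finf F" "1/2 \<le> cap (last_low kk n)"
proof -
  define B where "B N = low_block kk n - (\<Union>j\<in>{Suc n..<Suc n + N}. low_block kk j)" for N
  have B: "B N \<in> Finf F" for N
  proof -
    have "low_block kk n - (\<Union>j\<in>{Suc n..<Suc n + N}. low_block kk j) \<in> sets Minf"
      using low_block_sets by (intro sets.Diff sets.finite_UN) auto
    then show ?thesis by (simp add: B_def)
  qed
  have eq: "last_low kk n = (\<Inter>N. B N)"
  proof (intro set_eqI iffI)
    fix \<omega> assume *: "\<omega> \<in> (\<Inter>N. B N)"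
    then have "\<omega> \<in> low_block kk n" by (auto simp: B_def)
    moreover have "\<omega> \<notin> low_block kk j" if "j > n" for j
    proof -
      have "\<omega> \<in> B (j - n)" using * by blast
      then show ?thesis using that by (auto simp: B_def)
    qed
    ultimately show "\<omega> \<in> last_low kk n" by (simp add: last_low_def)
  qed (auto simp: last_low_def B_def)
  have "1/2 \<le> cap (B N)" for N
  proof -
    let ?\<Delta> = "\<Sum>i=kk n..<kk (Suc n). \<delta> i"
    let ?Q = "\<lambda>\<omega>. 1/4 - (G kk n \<omega> + ?\<Delta>)\<^sup>2 - (\<Sum>j=Suc n..<Suc n + N. (G kk j \<omega>)\<^sup>2)"
    have GH: "simple_function Minf (G kk j)" for j
      using G_simple by (rule simple_MF_Minf)
    have "simple_function Minf ?Q"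
      by (intro simple_function_diff simple_square simple_function_sum simple_function_add GH
        simple_function_const)
    then have QH: "?Q \<in> H" by (rule simple_in_H)
    \<comment> \<open>Outside \<open>B N\<close> some square is at least \<open>1/4\<close>: either
      block \<open>n\<close> is not low, so that its sum plus \<open>?\<Delta>\<close> exceeds
      \<open>1/2\<close>, or a later block sum is at most \<open>- 1/2\<close>.\<close>
    have pw: "?Q \<omega> \<le> 1/4 * indicator (B N) \<omega>" for \<omega>
    proof -
      define q where "q = (G kk n \<omega> + ?\<Delta>)\<^sup>2"
      define s where "s = (\<Sum>j=Suc n..<Suc n + N. (G kk j \<omega>)\<^sup>2)"
      have S0: "0 \<le> s" unfolding s_def by (intro sum_nonneg) auto
      have q0: "0 \<le> q" unfolding q_def by simp
      have ind: "0 \<le> (indicator (B N) \<omega> :: real)" by simp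
      have half: "1/4 \<le> x\<^sup>2" if "1/2 \<le> \<bar>x\<bar>" for x :: real
        using power_mono[OF that, of 2] by (simp add: power2_eq_square)
      consider "\<omega> \<in> B N" | "\<omega> \<notin> low_block kk n" | j where "j \<in> {Suc n..<Suc n + N}" "\<omega> \<in> low_block kk j"
        unfolding B_def by blast
      then have "1/4 - q - s \<le> 1/4 * indicator (B N) \<omega>"
      proof cases
        case 1
        then have "indicator (B N) \<omega> = (1::real)" by (rule indicator_simps)
        then show ?thesis using S0 q0 by linarith
      next
        case 2
        then have "1/4 \<le> q"
          unfolding q_def using \<delta> by (intro half) (simp add: low_block_def)
        then show ?thesis using S0 ind by linarith
      next
        case 3
        then have "1/4 \<le> (G kk j \<omega>)\<^sup>2"
          by (intro half) (simp add: low_block_def)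
        also have "\<dots> \<le> s"
          unfolding s_def using 3 by (intro member_le_sum) auto
        finally show ?thesis using q0 ind by linarith
      qed
      then show ?thesis by (simp only: q_def s_def)
    qed
    \<comment> \<open>The error is at most 4 times \<open>1/32\<close>, which is
      \<open>1/8\<close>.\<close>
    have "1/8 \<le> 1/4 - (\<Sum>i=kk n..<kk (Suc n + N). 4 * v i)"
      using v[of "kk (Suc n + N)"] by (simp flip: sum_distrib_left)
    also have "\<dots> \<le> e ?Q" by (rule e_blocks_ge[OF mono])
    also have "\<dots> \<le> e (\<lambda>\<omega>. 1/4 * indicator (B N) \<omega>)"
      using pw by (intro e_mono QH H_scale H_indicator B)
    also have "\<dots> = 1/4 * cap (B N)" by (intro e_scale H_indicator B) auto
    finally show ?thesis by simp
  qed
  moreover have "B (Suc N) \<subseteq> B N" for N by (auto simp: B_def)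
  ultimately show "1/2 \<le> cap (last_low kk n)"
    unfolding eq using B by (intro cap_INT_ge) auto
  show "last_low kk n \<in> Finf F"
    unfolding eq using sets.countable_INT[of B UNIV Minf] B by auto
qed

lemma \<delta>_summable: "summable \<delta>"
proof (rule ccontr)
  assume ns: "\<not> summable \<delta>"
  \<comment> \<open>Otherwise the partial sums from \<open>m\<close> on would be bounded by 1, and a
    nonnegative series with bounded partial sums converges.\<close>
  have ex: "\<exists>k\<ge>m. 1 \<le> (\<Sum>i=m..<k. \<delta> i)" for m
  proof (rule ccontr)
    assume "\<not> ?thesis"
    then have *: "(\<Sum>i=m..<k. \<delta> i) \<le> 1" if "m \<le> k" for k using that by force
    have "(\<Sum>i<n. \<delta> (i + m)) \<le> 1" for n
      using *[of "n + m"] sum.shift_bounds_nat_ivl[of \<delta> 0 m n]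
      by (simp add: atLeast0LessThan)
    then have "summable (\<lambda>i. \<delta> (i + m))"
      using \<delta>_nonneg by (intro summableI_nonneg_bounded)
    then show False using ns by simp
  qed
  then obtain nx where nx: "\<And>m. m \<le> nx m" "\<And>m. 1 \<le> (\<Sum>i=m..<nx m. \<delta> i)" by metis
  \<comment> \<open>Starting the blocks beyond \<open>m0\<close> respects the variance budget
    \<open>1/32\<close> required by \<open>cap_last_low\<close>.\<close>
  obtain m0 where m0: "\<And>m n. m0 \<le> m \<Longrightarrow> norm (\<Sum>i=m..<n. v i) < 1/32"
    using v_summable[unfolded summable_Cauchy, rule_format, of "1/32"] by auto
  define kk where "kk j = (nx ^^ j) m0" for j
  have kkS: "kk (Suc j) = nx (kk j)" for j by (simp add: kk_def)
  have mono: "mono kk" by (rule mono_iff_le_Suc[THEN iffD2]) (simp add: kkS nx)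
  have k0: "m0 \<le> kk j" for j using monoD[OF mono, of 0 j] by (simp add: kk_def)
  have v: "(\<Sum>i=kk n..<k. v i) \<le> 1/32" for n k
    using m0[OF k0, of n k] by simp
  have L: "last_low kk n \<in> Finf F" "1/2 \<le> cap (last_low kk n)" for n
    using cap_last_low[OF mono _ v, of n] nx(2)[of "kk n"] by (auto simp: kkS)
  \<comment> \<open>Each point lies in at most one of the disjoint events, so \<open>C n\<close>
    decreases to the empty set. Yet \<open>C n\<close> contains an event of capacity at least
    \<open>1/2\<close>, which is the contradiction.\<close>
  define C where "C n = (\<Union>k\<in>{n..}. last_low kk k)" for n
  have C: "C n \<in> Finf F" for n
    unfolding C_def using sets.countable_UN'[of "{n..}" "last_low kk" Minf] L by auto
  have "(\<lambda>n. cap (C n)) \<longlonglongrightarrow> 0"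
  proof (rule cap_tendsto_0[OF C])
    show "C (Suc n) \<subseteq> C n" for n unfolding C_def by (intro UN_mono) auto
    show "(\<Inter>n. C n) = {}"
    proof (rule equals0I)
      fix \<omega> assume *: "\<omega> \<in> (\<Inter>n. C n)"
      then have "\<omega> \<in> C 0" by blast
      then obtain k where k: "\<omega> \<in> last_low kk k" by (auto simp: C_def)
      have "\<omega> \<in> C (Suc k)" using * by blast
      then obtain k' where "k < k'" "\<omega> \<in> last_low kk k'" by (auto simp: C_def Suc_le_eq)
      with k last_low_disjoint show False by blast
    qed
  qed
  moreover have "1/2 \<le> cap (C n)" for n
    using L(2)[of n] cap_mono[OF L(1)[of n] C[of n]] by (force simp: C_def)
  ultimately have "(1/2::real) \<le> 0" by (intro LIMSEQ_le_const) auto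
  then show False by simp
qed

section \<open>Stopped partial sums and a maximal inequality\<close>

fun stopped :: "nat \<Rightarrow> real \<Rightarrow> nat \<Rightarrow> 'a \<Rightarrow> real" where
  "stopped m \<epsilon> 0 = (\<lambda>_. 0)"
| "stopped m \<epsilon> (Suc k) = (\<lambda>\<omega>. stopped m \<epsilon> k \<omega> + indicator {\<omega>. \<bar>stopped m \<epsilon> k \<omega>\<bar> < \<epsilon>} \<omega> * Y (m + k) \<omega>)"

lemma stopped_simple: "simple_function (MF (m + k)) (stopped m \<epsilon> k)"
proof (induction k)
  case (Suc k)
  have "{\<omega>. \<bar>stopped m \<epsilon> k \<omega>\<bar> < \<epsilon>} \<in> F (m + k)"
    using simple_set[OF Suc, of "\<lambda>x. \<bar>x\<bar> < \<epsilon>"] .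
  then have "simple_function (MF (m + k)) (indicator {\<omega>. \<bar>stopped m \<epsilon> k \<omega>\<bar> < \<epsilon>} :: 'a \<Rightarrow> real)"
    by (intro simple_function_indicator) auto
  then show ?case
    using simple_MF_mono[of "m + k" "m + Suc k"] Suc Y_simple[of "m + k"]
    by (auto intro!: simple_function_add simple_function_mult)
qed simp

text \<open>Without stopping, the cross term could pair the nonzero lower mean with an arbitrarily
  large partial sum. Freezing at level \<open>\<epsilon>\<close> limits its cost per step to
  \<open>2 * \<epsilon> * \<delta> n\<close>, which is summable.\<close>

lemma e_stopped_square:
  assumes \<epsilon>: "0 < \<epsilon>"
  shows "e (\<lambda>\<omega>. (stopped m \<epsilon> k \<omega>)\<^sup>2) \<le> (\<Sum>i<k. 2 * \<epsilon> * \<delta> (i + m) + v (i + m))"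
proof (induction k)
  case (Suc k)
  define R where "R = stopped m \<epsilon> k"
  define J where "J = {\<omega>. \<bar>R \<omega>\<bar> < \<epsilon>}"
  define n where "n = m + k"
  have R: "simple_function (MF n) R" unfolding R_def n_def by (rule stopped_simple)
  have J: "J \<in> F n" unfolding J_def using simple_set[OF R, of "\<lambda>x. \<bar>x\<bar> < \<epsilon>"] .
  define l where "l = (\<lambda>\<omega>. 2 * R \<omega> * indicator J \<omega>)"
  have l: "simple_function (MF n) l"
    unfolding l_def using R J
    by (intro simple_function_mult simple_function_indicator simple_function_const) auto
  have R2: "simple_function (MF n) (\<lambda>\<omega>. (R \<omega>)\<^sup>2)" using R by (rule simple_square)
  have YH: "Y n \<in> H" "(\<lambda>\<omega>. (Y n \<omega>)\<^sup>2) \<in> H"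
    using Y_simple[of n] by (auto intro: simple_MF_in_H simple_square)
  have lYH: "(\<lambda>\<omega>. l \<omega> * Y n \<omega>) \<in> H"
    using simple_function_mult[OF simple_MF_mono[OF _ l, of "Suc n"] Y_simple[of n]]
    by (auto intro: simple_MF_in_H)
  have JYH: "(\<lambda>\<omega>. indicator J \<omega> * (Y n \<omega>)\<^sup>2) \<in> H"
    using YH J F_subset_Finf by (intro H_indicator_mult) auto
  have "qs (\<lambda>\<omega>. E n (\<lambda>\<omega>. l \<omega> * Y n \<omega> + indicator J \<omega> * (Y n \<omega>)\<^sup>2) \<omega> \<le> 2 * \<epsilon> * \<delta> n + v n)"
    using qs_conj[OF qs_conj[OF Y_mean[of n] Y_lower_mean[of n]] Y_square[of n]]
  proof (rule qs_mono)
    fix \<omega> assume *: "(E n (Y n) \<omega> = 0 \<and> E n (\<lambda>\<omega>. - Y n \<omega>) \<omega> = \<delta> n) \<and> E n (\<lambda>\<omega>. (Y n \<omega>)\<^sup>2) \<omega> \<le> v n"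
    \<comment> \<open>By \<open>E_mult\<close> the positive part of \<open>l\<close> meets the upper
      mean 0, so only the negative part contributes; it is bounded because
      \<open>\<bar>R\<bar> < \<epsilon>\<close> on \<open>J\<close>.\<close>
    have "max (- l \<omega>) 0 \<le> 2 * \<epsilon>"
      using \<epsilon> by (auto simp: l_def J_def indicator_def)
    then have "E n (\<lambda>\<omega>. l \<omega> * Y n \<omega>) \<omega> \<le> 2 * \<epsilon> * \<delta> n"
      using * E_mult[OF simple_in_Hsub[OF l] YH(1) lYH, of \<omega>] \<delta>_nonneg[of n]
      by (simp add: mult_right_mono)
    moreover have "E n (\<lambda>\<omega>. indicator J \<omega> * (Y n \<omega>)\<^sup>2) \<omega> \<le> v n"
      using * E_indicator_mult[OF J YH(2)] v_nonneg[of n] by (auto simp: indicator_def)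
    ultimately show "E n (\<lambda>\<omega>. l \<omega> * Y n \<omega> + indicator J \<omega> * (Y n \<omega>)\<^sup>2) \<omega> \<le> 2 * \<epsilon> * \<delta> n + v n"
      using E_subadd[OF lYH JYH, of n \<omega>] by simp
  qed
  then have "e (\<lambda>\<omega>. (R \<omega>)\<^sup>2 + (l \<omega> * Y n \<omega> + indicator J \<omega> * (Y n \<omega>)\<^sup>2))
      \<le> e (\<lambda>\<omega>. (R \<omega>)\<^sup>2) + (2 * \<epsilon> * \<delta> n + v n)"
    using simple_in_Hsub[OF R2] lYH JYH by (intro e_add_le_qs) auto
  also have "(\<lambda>\<omega>. (R \<omega>)\<^sup>2 + (l \<omega> * Y n \<omega> + indicator J \<omega> * (Y n \<omega>)\<^sup>2)) = (\<lambda>\<omega>. (stopped m \<epsilon> (Suc k) \<omega>)\<^sup>2)"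
    by (auto simp: fun_eq_iff l_def J_def R_def n_def indicator_def power2_eq_square algebra_simps)
  finally show ?case using Suc by (simp add: R_def n_def add.commute)
qed simp

text \<open>The squares fit Markov's inequality for the second moment.\<close>

definition escape :: "nat \<Rightarrow> real \<Rightarrow> 'a set" where
  "escape m \<epsilon> = (\<Union>k. {\<omega>. \<epsilon>\<^sup>2 \<le> (stopped m \<epsilon> k \<omega>)\<^sup>2})"

text \<open>Freezing makes the exceedance sets increase with \<open>k\<close>, so the bound at each
  single time passes to their union by \<open>cap_UN_le\<close>. No union bound over times is
  involved.\<close>

lemma cap_escape:
  assumes \<epsilon>: "0 < \<epsilon>"
  shows "escape m \<epsilon> \<in> Finf F" "cap (escape m \<epsilon>) \<le> (\<Sum>i. 2 * \<epsilon> * \<delta> (i + m) + v (i + m)) / \<epsilon>\<^sup>2"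
proof -
  define A where "A k = {\<omega>. \<epsilon>\<^sup>2 \<le> (stopped m \<epsilon> k \<omega>)\<^sup>2}" for k
  have H: "(\<lambda>\<omega>. (stopped m \<epsilon> k \<omega>)\<^sup>2) \<in> H" for k
    using simple_square[OF stopped_simple] by (rule simple_MF_in_H)
  have A: "A k \<in> Finf F" "cap (A k) \<le> e (\<lambda>\<omega>. (stopped m \<epsilon> k \<omega>)\<^sup>2) / \<epsilon>\<^sup>2" for k
    using markov[OF H[of k], of "\<epsilon>\<^sup>2"] \<epsilon> by (auto simp: A_def)
  have "summable (\<lambda>i. 2 * \<epsilon> * \<delta> (i + m) + v (i + m))"
    using \<delta>_summable v_summable by (intro summable_add summable_mult) simp_all
  then have "(\<Sum>i<k. 2 * \<epsilon> * \<delta> (i + m) + v (i + m)) \<le> (\<Sum>i. 2 * \<epsilon> * \<delta> (i + m) + v (i + m))" for k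
    using \<delta>_nonneg v_nonneg \<epsilon> by (intro sum_le_suminf) auto
  then have "cap (A k) \<le> (\<Sum>i. 2 * \<epsilon> * \<delta> (i + m) + v (i + m)) / \<epsilon>\<^sup>2" for k
    using A(2)[of k] e_stopped_square[OF \<epsilon>, of m k]
    by (meson divide_right_mono order_trans zero_le_power2)
  moreover have "A k \<subseteq> A (Suc k)" for k
  proof
    fix \<omega> assume "\<omega> \<in> A k"
    then have "\<epsilon> \<le> \<bar>stopped m \<epsilon> k \<omega>\<bar>" using \<epsilon> by (simp add: A_def abs_le_square_iff[symmetric])
    then have "stopped m \<epsilon> (Suc k) \<omega> = stopped m \<epsilon> k \<omega>" by (simp add: indicator_def)
    with \<open>\<omega> \<in> A k\<close> show "\<omega> \<in> A (Suc k)" by (simp add: A_def del: stopped.simps)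
  qed
  ultimately show "cap (escape m \<epsilon>) \<le> (\<Sum>i. 2 * \<epsilon> * \<delta> (i + m) + v (i + m)) / \<epsilon>\<^sup>2"
    unfolding escape_def A_def[symmetric] using A by (intro cap_UN_le) auto
  show "escape m \<epsilon> \<in> Finf F"
    unfolding escape_def A_def[symmetric] using sets.countable_UN[of A UNIV Minf] A by auto
qed

text \<open>Outside the escape set the process is never frozen, so it coincides with the true
  partial sums.\<close>

lemma partial_sums_not_escape:
  assumes \<epsilon>: "0 < \<epsilon>" and \<omega>: "\<omega> \<notin> escape m \<epsilon>"
  shows "\<bar>\<Sum>i<k. Y (m + i) \<omega>\<bar> < \<epsilon>"
proof -
  have lt: "\<bar>stopped m \<epsilon> k \<omega>\<bar> < \<epsilon>" for k
  proof (rule ccontr)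
    assume "\<not> ?thesis"
    then have "\<epsilon>\<^sup>2 \<le> (stopped m \<epsilon> k \<omega>)\<^sup>2"
      using \<epsilon> by (simp add: abs_le_square_iff[symmetric])
    then show False using \<omega> by (auto simp: escape_def)
  qed
  have "stopped m \<epsilon> k \<omega> = (\<Sum>i<k. Y (m + i) \<omega>)"
  proof (induction k)
    case (Suc k)
    have "stopped m \<epsilon> (Suc k) \<omega> = stopped m \<epsilon> k \<omega> + Y (m + k) \<omega>"
      using lt[of k] by simp
    with Suc show ?case by simp
  qed simp
  with lt[of k] show ?thesis by simp
qed

text \<open>For each level \<open>1 / real (Suc p)\<close> the escape capacities tend to 0 as the
  starting index grows. Quasi-surely some start therefore avoids escape at every level, which yields
  the Cauchy criterion.\<close>

lemma qs_summable: "qs (\<lambda>\<omega>. summable (\<lambda>i. Y i \<omega>))"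
proof -
  have "qs (\<lambda>\<omega>. \<exists>m. \<omega> \<notin> escape m (1 / real (Suc p)))" for p
  proof (rule qs_notin_all)
    let ?\<epsilon> = "1 / real (Suc p)"
    let ?f = "\<lambda>i. 2 * ?\<epsilon> * \<delta> i + v i"
    have \<epsilon>: "0 < ?\<epsilon>" by simp
    show "escape m ?\<epsilon> \<in> Finf F" "cap (escape m ?\<epsilon>) \<le> (\<Sum>i. ?f (i + m)) / ?\<epsilon>\<^sup>2" for m
      using cap_escape[OF \<epsilon>] by blast+
    have "summable ?f"
      using \<delta>_summable v_summable by (intro summable_add summable_mult)
    then have "(\<lambda>m. \<Sum>i. ?f (i + m)) \<longlonglongrightarrow> 0" by (rule suminf_exist_split2)
    then show "(\<lambda>m. (\<Sum>i. ?f (i + m)) / ?\<epsilon>\<^sup>2) \<longlonglongrightarrow> 0"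
      by (rule tendsto_divide_zero)
  qed
  then have "qs (\<lambda>\<omega>. \<forall>p. \<exists>m. \<omega> \<notin> escape m (1 / real (Suc p)))" by (rule qs_all)
  then show ?thesis
  proof (rule qs_mono)
    fix \<omega> assume *: "\<forall>p. \<exists>m. \<omega> \<notin> escape m (1 / real (Suc p))"
    show "summable (\<lambda>i. Y i \<omega>)"
      unfolding summable_Cauchy
    proof (intro allI impI)
      fix r :: real assume "0 < r"
      then obtain p where p: "1 / real (Suc p) < r / 2"
        using nat_approx_posE[of "r/2"] by auto
      obtain m where m: "\<omega> \<notin> escape m (1 / real (Suc p))" using * by blast
      have S: "\<bar>\<Sum>i=m..<n. Y i \<omega>\<bar> < r / 2" if "m \<le> n" for n
      proof -
        have "(\<Sum>i=m..<n. Y i \<omega>) = (\<Sum>i<n - m. Y (m + i) \<omega>)"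
          using sum.shift_bounds_nat_ivl[of "\<lambda>i. Y i \<omega>" 0 m "n - m"] that
          by (simp add: atLeast0LessThan add.commute)
        then show ?thesis using partial_sums_not_escape[OF _ m, of "n - m"] p by simp
      qed
      show "\<exists>N. \<forall>a\<ge>N. \<forall>n. norm (\<Sum>i=a..<n. Y i \<omega>) < r"
      proof (intro exI allI impI)
        fix a n assume a: "m \<le> a"
        show "norm (\<Sum>i=a..<n. Y i \<omega>) < r"
        proof (cases "a \<le> n")
          case True
          then have "(\<Sum>i=m..<n. Y i \<omega>) = (\<Sum>i=m..<a. Y i \<omega>) + (\<Sum>i=a..<n. Y i \<omega>)"
            using a by (simp add: sum.atLeastLessThan_concat)
          then show ?thesis using S[of a] S[of n] a True unfolding real_norm_def by arith
        qed (use \<open>0 < r\<close> in simp)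
      qed
    qed
  qed
qed

end

section \<open>Tools on the real line: Kronecker's lemma and rounding to a finite grid\<close>

lemma kronecker:
  fixes w b :: "nat \<Rightarrow> real"
  assumes w: "summable w" and pos: "\<And>n. 0 < b n" and inc: "\<And>n. b n \<le> b (Suc n)"
    and lim: "filterlim b at_top sequentially"
  shows "(\<lambda>n. (\<Sum>i\<le>n. b i * w i) / b n) \<longlonglongrightarrow> 0"
proof -
  define r where "r n = (\<Sum>i<n. w i) - suminf w" for n
  have r0: "r \<longlonglongrightarrow> 0"
    using summable_LIMSEQ[OF w] unfolding r_def by (rule LIM_zero)
  \<comment> \<open>Summation by parts, using that \<open>w i = r (Suc i) - r i\<close>.\<close>
  have abel: "(\<Sum>i\<le>n. b i * w i) = b n * r (Suc n) - b 0 * r 0 - (\<Sum>i<n. (b (Suc i) - b i) * r (Suc i))" for n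
    by (induction n) (auto simp: r_def algebra_simps)
  have bmono: "b m \<le> b n" if "m \<le> n" for m n using that by (rule lift_Suc_mono_le[of b, OF inc])
  have inv: "(\<lambda>n. c / b n) \<longlonglongrightarrow> 0" for c
    by (rule tendsto_divide_0[OF tendsto_const filterlim_at_top_imp_at_infinity[OF lim]])
  have avg: "(\<lambda>n. (\<Sum>i<n. (b (Suc i) - b i) * r (Suc i)) / b n) \<longlonglongrightarrow> 0"
  proof (rule LIMSEQ_I)
    fix \<epsilon> :: real assume \<epsilon>: "0 < \<epsilon>"
    obtain m where m: "\<And>i. m \<le> i \<Longrightarrow> \<bar>r i\<bar> < \<epsilon> / 2"
      using LIMSEQ_D[OF r0, of "\<epsilon>/2"] \<epsilon> by auto
    \<comment> \<open>\<open>T\<close> is a fixed number and disappears after division by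
      \<open>b n\<close>. Beyond \<open>m\<close> the factors \<open>r (Suc i)\<close> are small and
      the increments of \<open>b\<close> telescope.\<close>
    define T where "T = (\<Sum>i<m. (b (Suc i) - b i) * r (Suc i))"
    obtain m' where m': "\<And>n. m' \<le> n \<Longrightarrow> \<bar>T / b n\<bar> < \<epsilon> / 2"
      using LIMSEQ_D[OF inv[of T], of "\<epsilon>/2"] \<epsilon> by auto
    show "\<exists>no. \<forall>n\<ge>no. norm ((\<Sum>i<n. (b (Suc i) - b i) * r (Suc i)) / b n - 0) < \<epsilon>"
    proof (intro exI allI impI)
      fix n assume n: "max m m' \<le> n"
      have bd: "\<bar>\<Sum>i=m..<n. (b (Suc i) - b i) * r (Suc i)\<bar> \<le> \<epsilon> / 2 * b n"
      proof -
        have "\<bar>\<Sum>i=m..<n. (b (Suc i) - b i) * r (Suc i)\<bar> \<le> (\<Sum>i=m..<n. (b (Suc i) - b i) * (\<epsilon> / 2))"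
        proof (intro sum_abs[THEN order_trans] sum_mono)
          fix i assume "i \<in> {m..<n}"
          then have "\<bar>r (Suc i)\<bar> \<le> \<epsilon> / 2" using m[of "Suc i"] by auto
          then show "\<bar>(b (Suc i) - b i) * r (Suc i)\<bar> \<le> (b (Suc i) - b i) * (\<epsilon> / 2)"
            unfolding abs_mult using inc[of i] by (intro mult_mono) auto
        qed
        also have "\<dots> = (b n - b m) * (\<epsilon> / 2)"
          using n by (simp add: sum_Suc_diff' flip: sum_distrib_right sum_divide_distrib)
        also have "\<dots> \<le> b n * (\<epsilon> / 2)"
          using \<epsilon> pos[of m] by (intro mult_right_mono) auto
        finally show ?thesis by (simp add: mult.commute)
      qed
      have "(\<Sum>i<n. (b (Suc i) - b i) * r (Suc i)) = T + (\<Sum>i=m..<n. (b (Suc i) - b i) * r (Suc i))"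
        using n by (simp add: T_def sum.atLeastLessThan_concat flip: atLeast0LessThan)
      moreover have "\<bar>(\<Sum>i=m..<n. (b (Suc i) - b i) * r (Suc i)) / b n\<bar> \<le> \<epsilon> / 2"
        using bd pos[of n] by (simp add: abs_divide pos_divide_le_eq)
      ultimately show "norm ((\<Sum>i<n. (b (Suc i) - b i) * r (Suc i)) / b n - 0) < \<epsilon>"
        using m'[of n] n by (simp only: real_norm_def add_divide_distrib max.bounded_iff) argo
    qed
  qed
  have "(\<lambda>n. r (Suc n) - (b 0 * r 0) / b n - (\<Sum>i<n. (b (Suc i) - b i) * r (Suc i)) / b n) \<longlonglongrightarrow> 0 - 0 - 0"
    by (intro tendsto_diff LIMSEQ_Suc[OF r0] inv avg)
  moreover have "r (Suc n) - (b 0 * r 0) / b n - (\<Sum>i<n. (b (Suc i) - b i) * r (Suc i)) / b n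
      = (\<Sum>i\<le>n. b i * w i) / b n" for n
    using pos[of n] unfolding abel by (simp add: diff_divide_distrib)
  ultimately show ?thesis by simp
qed

text \<open>Truncation at level \<open>k\<close> combined with rounding down to multiples of
  \<open>1 / real (Suc k)\<close>. Using \<open>Suc k\<close> avoids a zero mesh denominator at
  \<open>k = 0\<close>.\<close>

definition grid :: "nat \<Rightarrow> real \<Rightarrow> real" where
  "grid k x = (if \<bar>x\<bar> \<le> real k then of_int \<lfloor>real (Suc k) * x\<rfloor> / real (Suc k) else 0)"

lemma grid_measurable [measurable]: "grid k \<in> borel_measurable borel"
  unfolding grid_def by measurable

lemma grid_floor_error: "\<bar>of_int \<lfloor>real (Suc k) * x\<rfloor> / real (Suc k) - x\<bar> \<le> 1 / real (Suc k)"
proof -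
  have "\<bar>of_int \<lfloor>real (Suc k) * x\<rfloor> - real (Suc k) * x\<bar> \<le> 1" by linarith
  moreover have "of_int \<lfloor>real (Suc k) * x\<rfloor> / real (Suc k) - x
      = (of_int \<lfloor>real (Suc k) * x\<rfloor> - real (Suc k) * x) / real (Suc k)"
    by (simp add: field_simps)
  ultimately show ?thesis by (simp only: abs_divide) (auto intro: divide_right_mono)
qed

lemma grid_error: "\<bar>grid k x - x\<bar> \<le> 1 / real (Suc k) + indicator {x. \<bar>x\<bar> > real k} x * \<bar>x\<bar>"
  using grid_floor_error[of k x] by (auto simp: grid_def indicator_def)

lemma abs_grid_le: "\<bar>grid k x\<bar> \<le> \<bar>x\<bar> + 1 / real (Suc k)"
  using grid_floor_error[of k x] by (auto simp: grid_def)

text \<open>On the truncation interval the rounded numerators are integers of absolute value at most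
  \<open>Suc k * k\<close>.\<close>

lemma finite_range_grid: "finite (range (grid k))"
proof (rule finite_subset)
  define m where "m = int (Suc k * k)"
  show "range (grid k) \<subseteq> insert 0 ((\<lambda>i. of_int i / real (Suc k)) ` {- m..m})"
  proof (intro subsetI)
    fix y assume "y \<in> range (grid k)"
    then obtain x where x: "y = grid k x" by blast
    have "\<lfloor>real (Suc k) * x\<rfloor> \<in> {- m..m}" if "\<bar>x\<bar> \<le> real k"
    proof -
      have "\<bar>real (Suc k) * x\<bar> \<le> real (Suc k) * real k"
        using that by (simp only: abs_mult) (auto intro: mult_left_mono)
      moreover have "real_of_int m = real (Suc k) * real k" by (simp add: m_def algebra_simps)
      ultimately have "- of_int m \<le> real (Suc k) * x" "real (Suc k) * x \<le> of_int m"
        by linarith+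
      then show ?thesis by (auto simp: le_floor_iff floor_le_iff simp del: of_nat_Suc)
    qed
    then show "y \<in> insert 0 ((\<lambda>i. of_int i / real (Suc k)) ` {- m..m})"
      unfolding x grid_def by auto
  qed
qed simp

section \<open>Quasi-sure convergence of independent series\<close>

context sublinear_expectation
begin

lemma grid_simple:
  assumes "W \<in> borel_measurable (MF t)" shows "simple_function (MF t) (\<lambda>\<omega>. grid k (W \<omega>))"
proof (rule simple_function_borel_measurable)
  show "(\<lambda>\<omega>. grid k (W \<omega>)) \<in> borel_measurable (MF t)" using assms by measurable
  show "finite ((\<lambda>\<omega>. grid k (W \<omega>)) ` space (MF t))"
    using finite_range_grid[of k] by (rule finite_subset[rotated]) auto
qed

lemma e_grid_error_tendsto_0:
  assumes W: "W \<in> H" and G: "\<And>k. (\<lambda>\<omega>. grid k (W \<omega>)) \<in> H"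
  shows "(\<lambda>k. e (\<lambda>\<omega>. \<bar>grid k (W \<omega>) - W \<omega>\<bar>)) \<longlonglongrightarrow> 0"
proof (rule tendsto_sandwich[OF _ _ tendsto_const])
  have tail: "(\<lambda>\<omega>. indicator {\<omega>. \<bar>W \<omega>\<bar> > real k} \<omega> * \<bar>W \<omega>\<bar>) \<in> H" for k
  proof -
    have "{\<omega> \<in> space Minf. \<bar>W \<omega>\<bar> > real k} \<in> sets Minf"
      using W by measurable
    then show ?thesis using W by auto
  qed
  have "e (\<lambda>\<omega>. \<bar>grid k (W \<omega>) - W \<omega>\<bar>)
      \<le> e (\<lambda>\<omega>. indicator {\<omega>. \<bar>W \<omega>\<bar> > real k} \<omega> * \<bar>W \<omega>\<bar> + 1 / real (Suc k))" for k
    using grid_error[of k] by (intro e_mono H_add H_abs H_diff W G tail H_const)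
      (simp add: indicator_def add.commute)
  then show "\<forall>\<^sub>F k in sequentially. e (\<lambda>\<omega>. \<bar>grid k (W \<omega>) - W \<omega>\<bar>)
      \<le> e (\<lambda>\<omega>. indicator {\<omega>. \<bar>W \<omega>\<bar> > real k} \<omega> * \<bar>W \<omega>\<bar>) + 1 / real (Suc k)"
    by (simp add: e_add_const[OF tail] del: of_nat_Suc)
  show "\<forall>\<^sub>F k in sequentially. 0 \<le> e (\<lambda>\<omega>. \<bar>grid k (W \<omega>) - W \<omega>\<bar>)"
    by (intro always_eventually allI e_nonneg H_abs H_diff W G) simp
  show "(\<lambda>k. e (\<lambda>\<omega>. indicator {\<omega>. \<bar>W \<omega>\<bar> > real k} \<omega> * \<bar>W \<omega>\<bar>) + 1 / real (Suc k)) \<longlonglongrightarrow> 0"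
    using tendsto_add[OF e_tail_tendsto_0[OF W] LIMSEQ_Suc[OF lim_1_over_n]] by simp
qed

text \<open>A Borel-Cantelli argument: Markov's inequality at the level \<open>(1/2)^i\<close> gives
  exceedance capacities \<open>(1/4)^i / (1/2)^i = (1/2)^i\<close>, whose tails are
  geometric.\<close>

lemma qs_summable_abs:
  assumes D: "\<And>i. D i \<in> H" and nn: "\<And>i \<omega>. 0 \<le> D i \<omega>" and le: "\<And>i. e (D i) \<le> (1/4)^i"
  shows "qs (\<lambda>\<omega>. summable (\<lambda>i. D i \<omega>))"
proof -
  define A where "A i = {\<omega>. (1/2)^i \<le> D i \<omega>}" for i
  have A: "A i \<in> Finf F" "cap (A i) \<le> (1/2)^i" for i
  proof -
    show "A i \<in> Finf F" unfolding A_def by (rule markov(1)[OF D nn]) simp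
    have "cap (A i) \<le> e (D i) / (1/2)^i" unfolding A_def by (rule markov(2)[OF D nn]) simp
    also have "\<dots> \<le> (1/4)^i / (1/2)^i" using le by (intro divide_right_mono) auto
    also have "\<dots> = (1/2)^i" by (simp flip: power_divide)
    finally show "cap (A i) \<le> (1/2)^i" .
  qed
  define P where "P m k = (\<Union>i\<in>{m..<m+k}. A i)" for m k
  have PF: "P m k \<in> Finf F" for m k
    unfolding P_def using sets.finite_UN[of "{m..<m+k}" A Minf] A by auto
  \<comment> \<open>The exact finite geometric sum is carried along so that the induction
    closes.\<close>
  have "cap (P m k) \<le> 2 * (1/2)^m - 2 * (1/2)^(m+k)" for m k
  proof (induction k)
    case (Suc k)
    have "P m (Suc k) = P m k \<union> A (m + k)"
      by (force simp: P_def less_Suc_eq)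
    then show ?case using cap_Un[OF PF[of m k] A(1)[of "m+k"]] A(2)[of "m+k"] Suc by simp
  qed (simp add: P_def)
  then have Ple: "cap (P m k) \<le> 2 * (1/2)^m" for m k
    by (rule order_trans) simp
  define B where "B m = (\<Union>k. P m k)" for m
  have "qs (\<lambda>\<omega>. \<exists>m. \<omega> \<notin> B m)"
  proof (rule qs_notin_all)
    show "B m \<in> Finf F" for m
      unfolding B_def using sets.countable_UN[of "P m" UNIV Minf] PF by auto
    show "cap (B m) \<le> 2 * (1/2)^m" for m
      unfolding B_def using PF Ple by (intro cap_UN_le) (force simp: P_def)+
    show "(\<lambda>m. 2 * (1/2)^m :: real) \<longlonglongrightarrow> 0"
      by (intro tendsto_mult_right_zero LIMSEQ_power_zero) simp
  qed
  then show ?thesis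
  proof (rule qs_mono)
    fix \<omega> assume "\<exists>m. \<omega> \<notin> B m"
    then obtain m where m: "\<omega> \<notin> B m" by blast
    have "D i \<omega> \<le> (1/2)^i" if "m \<le> i" for i
    proof -
      have "\<omega> \<notin> P m (Suc i - m)" using m by (auto simp: B_def)
      then have "\<omega> \<notin> A i" using that by (auto simp: P_def)
      then show ?thesis by (auto simp: A_def)
    qed
    then show "summable (\<lambda>i. D i \<omega>)"
      using nn by (intro summable_comparison_test'[OF summable_geometric[of "1/2"], of m]) simp_all
  qed
qed

text \<open>Each \<open>W n\<close> is replaced by a recentred grid value \<open>Y n\<close>, so
  that all squares and products with past simple functions stay in \<open>H\<close>. The assumption
  \<open>cond\<close> passes to \<open>Y n\<close> because \<open>Y n\<close> is a Borel function of
  \<open>W n\<close>.\<close>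

theorem qs_summable_independent:
  assumes W: "\<And>n. W n \<in> H" "\<And>n. W n \<in> borel_measurable (MF (Suc n))"
    and mean: "\<And>n. e (W n) = 0"
    and cond: "\<And>n f. f \<in> borel_measurable borel \<Longrightarrow> (\<lambda>\<omega>. f (W n \<omega>)) \<in> H
        \<Longrightarrow> qs (\<lambda>\<omega>. E n (\<lambda>\<omega>. f (W n \<omega>)) \<omega> = e (\<lambda>\<omega>. f (W n \<omega>)))"
    and W2: "\<And>n. (\<lambda>\<omega>. (W n \<omega>)\<^sup>2) \<in> H" and summ: "summable (\<lambda>n. e (\<lambda>\<omega>. (W n \<omega>)\<^sup>2))"
  shows "qs (\<lambda>\<omega>. summable (\<lambda>n. W n \<omega>))"
proof -
  have gs: "simple_function (MF (Suc n)) (\<lambda>\<omega>. grid k (W n \<omega>))" for n k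
    by (rule grid_simple[OF W(2)])
  have gH: "(\<lambda>\<omega>. grid k (W n \<omega>)) \<in> H" for n k
    using gs by (rule simple_MF_in_H)
  have "\<exists>k. e (\<lambda>\<omega>. \<bar>grid k (W n \<omega>) - W n \<omega>\<bar>) \<le> (1/4)^n \<and> 1 / real (Suc k) \<le> (1/4)^n" for n
  proof -
    have "\<forall>\<^sub>F k in sequentially. e (\<lambda>\<omega>. \<bar>grid k (W n \<omega>) - W n \<omega>\<bar>) < (1/4)^n"
      by (rule order_tendstoD(2)[OF e_grid_error_tendsto_0[OF W(1) gH]]) simp
    moreover have "\<forall>\<^sub>F k in sequentially. 1 / real (Suc k) < (1/4)^n"
      by (rule order_tendstoD(2)[OF LIMSEQ_Suc[OF lim_1_over_n]]) simp
    ultimately have "\<forall>\<^sub>F k in sequentially. e (\<lambda>\<omega>. \<bar>grid k (W n \<omega>) - W n \<omega>\<bar>) \<le> (1/4)^n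
        \<and> 1 / real (Suc k) \<le> (1/4)^n"
      by eventually_elim simp
    then show ?thesis by (rule eventually_happens'[OF sequentially_bot])
  qed
  \<comment> \<open>The mean error controls the recentring constants and feeds
    \<open>qs_summable_abs\<close>; the mesh bound enters the variance estimate.\<close>
  then obtain k where k: "\<And>n. e (\<lambda>\<omega>. \<bar>grid (k n) (W n \<omega>) - W n \<omega>\<bar>) \<le> (1/4)^n"
    "\<And>n. 1 / real (Suc (k n)) \<le> (1/4)^n" by metis
  define Z where "Z n \<omega> = grid (k n) (W n \<omega>)" for n \<omega>
  define a where "a n = e (Z n)" for n
  define Y where "Y n \<omega> = Z n \<omega> - a n" for n \<omega>
  have ZH: "Z n \<in> H" for n using gH by (simp add: Z_def[abs_def])
  have a: "\<bar>a n\<bar> \<le> (1/4)^n" for n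
    using e_abs_diff[OF ZH[of n] W(1)[of n]] mean[of n] k(1)[of n] by (simp add: a_def Z_def)
  have Ys: "simple_function (MF (Suc n)) (Y n)" for n
    using gs[of n "k n"] by (auto simp: Y_def[abs_def] Z_def)
  have YH: "Y n \<in> H" for n using Ys by (rule simple_MF_in_H)
  have Y0: "e (Y n) = 0" for n
    using e_add_const[OF ZH[of n], of "- a n"] by (simp add: Y_def[abs_def] a_def)
  have Ycond: "qs (\<lambda>\<omega>. E n (\<lambda>\<omega>. f (Y n \<omega>)) \<omega> = e (\<lambda>\<omega>. f (Y n \<omega>)))"
    if f: "f \<in> borel_measurable borel" "(\<lambda>\<omega>. f (Y n \<omega>)) \<in> H" for f n
    using cond[of "\<lambda>x. f (grid (k n) x - a n)" n] f by (simp add: Y_def Z_def)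
  define \<delta> where "\<delta> n = e (\<lambda>\<omega>. - Y n \<omega>)" for n
  define v where "v n = e (\<lambda>\<omega>. (Y n \<omega>)\<^sup>2)" for n
  have Y2H: "(\<lambda>\<omega>. (Y n \<omega>)\<^sup>2) \<in> H" for n
    using simple_square[OF Ys] by (rule simple_MF_in_H)
  have "centered_increments F H E Y \<delta> v"
  proof
    show "simple_function (MF (Suc i)) (Y i)" for i by (rule Ys)
    show "qs (\<lambda>\<omega>. E i (Y i) \<omega> = 0)" for i
      using Ycond[of "\<lambda>x. x" i] YH Y0 by simp
    show "qs (\<lambda>\<omega>. E i (\<lambda>\<omega>. - Y i \<omega>) \<omega> = \<delta> i)" for i
      using Ycond[of uminus i] YH by (auto simp: \<delta>_def)
    have "qs (\<lambda>\<omega>. E i (\<lambda>\<omega>. (Y i \<omega>)\<^sup>2) \<omega> = v i)" for i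
      using Ycond[of "\<lambda>x. x\<^sup>2" i] Y2H by (auto simp: v_def)
    then show "qs (\<lambda>\<omega>. E i (\<lambda>\<omega>. (Y i \<omega>)\<^sup>2) \<omega> \<le> v i)" for i
      by (rule qs_mono[where P="\<lambda>\<omega>. E i (\<lambda>\<omega>. (Y i \<omega>)\<^sup>2) \<omega> = v i"]) auto
    show \<delta>0: "0 \<le> \<delta> i" for i
      using e_uminus_ge[OF YH[of i]] Y0 by (simp add: \<delta>_def)
    show "(\<delta> i)\<^sup>2 \<le> v i" for i
    proof -
      \<comment> \<open>A substitute for Jensen's inequality: the upper expectation of
        \<open>2 * \<delta> i * (- Y i) \<le> (Y i)^2 + (\<delta> i)^2\<close> gives
        \<open>2 * (\<delta> i)^2 \<le> v i + (\<delta> i)^2\<close>.\<close>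
      have "2 * \<delta> i * \<delta> i = e (\<lambda>\<omega>. (2 * \<delta> i) * (- Y i \<omega>))"
        using \<delta>0[of i] YH by (subst e_scale) (auto simp: \<delta>_def)
      also have "\<dots> \<le> e (\<lambda>\<omega>. (Y i \<omega>)\<^sup>2 + (\<delta> i)\<^sup>2)"
      proof (intro e_mono H_scale H_uminus YH H_add Y2H H_const)
        show "(2 * \<delta> i) * (- Y i \<omega>) \<le> (Y i \<omega>)\<^sup>2 + (\<delta> i)\<^sup>2" for \<omega>
          using zero_le_power2[of "Y i \<omega> + \<delta> i"] by (simp add: power2_eq_square algebra_simps)
      qed
      also have "\<dots> = v i + (\<delta> i)\<^sup>2" using e_add_const[OF Y2H] by (simp add: v_def)
      finally show ?thesis by (simp add: power2_eq_square)
    qed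
    show "summable v"
    proof (rule summable_comparison_test')
      \<comment> \<open>Mesh and recentring each cost at most \<open>(1/4)^n\<close>. Squaring
        \<open>\<bar>W n\<bar> + 2 * (1/4)^n\<close> with
        \<open>(x + y)^2 \<le> 2 * x^2 + 2 * y^2\<close> gives these constants.\<close>
      show "summable (\<lambda>n. 2 * e (\<lambda>\<omega>. (W n \<omega>)\<^sup>2) + 8 * (1/16)^n)"
        using summ by (intro summable_add summable_mult summable_geometric) auto
      fix n
      have "0 \<le> v n" unfolding v_def using Y2H by (intro e_nonneg) auto
      moreover have "v n \<le> e (\<lambda>\<omega>. 2 * (W n \<omega>)\<^sup>2 + 8 * (1/16)^n)"
        unfolding v_def
      proof (intro e_mono Y2H H_add H_scale W2 H_const)
        fix \<omega>
        have "\<bar>Y n \<omega>\<bar> \<le> \<bar>W n \<omega>\<bar> + 2 * (1/4)^n"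
          using abs_grid_le[of "k n" "W n \<omega>"] k(2)[of n] a[of n] by (auto simp: Y_def Z_def)
        then have "(Y n \<omega>)\<^sup>2 \<le> (\<bar>W n \<omega>\<bar> + 2 * (1/4)^n)\<^sup>2"
          using power_mono[of "\<bar>Y n \<omega>\<bar>" _ 2] by simp
        also have "\<dots> \<le> 2 * \<bar>W n \<omega>\<bar>\<^sup>2 + 2 * (2 * (1/4)^n)\<^sup>2"
          using zero_le_power2[of "\<bar>W n \<omega>\<bar> - 2 * (1/4)^n"] unfolding power2_eq_square
          by (simp add: algebra_simps)
        also have "(2 * (1/4)^n)\<^sup>2 = (4 * (1/16)^n :: real)"
          by (simp add: power_mult_distrib power2_eq_square flip: power_mult_distrib)
        finally show "(Y n \<omega>)\<^sup>2 \<le> 2 * (W n \<omega>)\<^sup>2 + 8 * (1/16)^n" by simp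
      qed
      moreover have "\<dots> = 2 * e (\<lambda>\<omega>. (W n \<omega>)\<^sup>2) + 8 * (1/16)^n"
        using e_add_const[OF H_scale[OF W2]] e_scale[OF W2, of 2 n] by simp
      ultimately show "norm (v n) \<le> 2 * e (\<lambda>\<omega>. (W n \<omega>)\<^sup>2) + 8 * (1/16)^n" by simp
    qed
  qed
  then have Ysum: "qs (\<lambda>\<omega>. summable (\<lambda>n. Y n \<omega>))"
    by (rule centered_increments.qs_summable)
  have Dsum: "qs (\<lambda>\<omega>. summable (\<lambda>n. \<bar>Z n \<omega> - W n \<omega>\<bar>))"
  proof (rule qs_summable_abs)
    show "(\<lambda>\<omega>. \<bar>Z n \<omega> - W n \<omega>\<bar>) \<in> H" for n by (intro H_abs H_diff ZH W(1))
    show "e (\<lambda>\<omega>. \<bar>Z n \<omega> - W n \<omega>\<bar>) \<le> (1/4)^n" for n unfolding Z_def by (rule k(1))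
  qed (rule abs_ge_zero)
  have asum: "summable a"
  proof (rule summable_comparison_test'[OF summable_geometric[of "1/4"]])
    show "norm (a n) \<le> (1/4)^n" for n using a[of n] by (simp only: real_norm_def)
  qed simp
  show ?thesis
    using qs_conj[OF Ysum Dsum]
  proof (rule qs_mono)
    fix \<omega> assume *: "summable (\<lambda>n. Y n \<omega>) \<and> summable (\<lambda>n. \<bar>Z n \<omega> - W n \<omega>\<bar>)"
    then have "summable (\<lambda>n. Z n \<omega> - W n \<omega>)" by (rule conjunct2[THEN summable_rabs_cancel])
    \<comment> \<open>The summand equals \<open>W n \<omega>\<close>, because
      \<open>Y n \<omega> + a n = Z n \<omega>\<close>.\<close>
    then have "summable (\<lambda>n. Y n \<omega> + a n - (Z n \<omega> - W n \<omega>))"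
      using * asum by (intro summable_diff[OF summable_add]) auto
    then show "summable (\<lambda>n. W n \<omega>)" by (simp add: Y_def)
  qed
qed

end

section \<open>The strong law, from series to weighted averages\<close>

theorem theorem4p3:
  fixes F :: "nat \<Rightarrow> 'a set set"
    and H :: "('a \<Rightarrow> real) set"
    and E :: "nat \<Rightarrow> ('a \<Rightarrow> real) \<Rightarrow> ('a \<Rightarrow> real)"
    and X :: "nat \<Rightarrow> 'a \<Rightarrow> real"
    and b :: "nat \<Rightarrow> real"
  assumes filt: "filtration_on F"
    and H: "rv_space F H"
    and SL: "SL_expectation F H E"
    and X_adapted: "\<And>i. i \<ge> 1 \<Longrightarrow> X i \<in> Hsub F H i"
    and X_indep: "\<And>i. i \<ge> 1 \<Longrightarrow> indep_of_sigma F H E (X i) (i - 1)"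
    and X_bdd_or_L1b: "\<And>i. i \<ge> 1 \<Longrightarrow> (\<exists>c. \<forall>\<omega>. c \<le> X i \<omega>) \<or> L1b H E (X i)"
    and b_pos: "\<And>n. n \<ge> 1 \<Longrightarrow> b n > 0"
    and b_incr: "\<And>m n. 1 \<le> m \<Longrightarrow> m \<le> n \<Longrightarrow> b m \<le> b n"
    and b_lim: "filterlim b at_top sequentially"
    and sq_in_H: "\<And>n. n \<ge> 1 \<Longrightarrow> (\<lambda>\<omega>. (X n \<omega> - Ex0 E (X n))\<^sup>2) \<in> H"
    and summ: "summable (\<lambda>n. Ex0 E (\<lambda>\<omega>. (X (Suc n) \<omega> - Ex0 E (X (Suc n)))\<^sup>2) / (b (Suc n))\<^sup>2)"
  shows "quasi_surely F E
           (\<lambda>\<omega>. (\<lambda>n. (\<Sum>i=1..n. X i \<omega> - Ex0 E (X i)) / b n) \<longlonglongrightarrow> 0)"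
proof -
  interpret sublinear_expectation F H E
    using filt H SL by unfold_locales
  \<comment> \<open>The index shift matches the convention of the series theorem:
    \<open>X (Suc n)\<close> is measurable at time \<open>Suc n\<close> and independent of
    \<open>F n\<close>.\<close>
  define U where "U n \<omega> = X (Suc n) \<omega> - e (X (Suc n))" for n \<omega>
  define c where "c n = 1 / b (Suc n)" for n
  define W where "W n \<omega> = c n * U n \<omega>" for n \<omega>
  have b: "0 < b (Suc n)" and c: "0 < c n" for n using b_pos[of "Suc n"] by (auto simp: c_def)
  have XH: "X (Suc n) \<in> H" and Xm: "X (Suc n) \<in> borel_measurable (MF (Suc n))" for n
    using X_adapted[of "Suc n"] by (auto simp: Hsub_iff)
  have UH: "U n \<in> H" for n unfolding U_def[abs_def] using XH by auto
  have U2H: "(\<lambda>\<omega>. (U n \<omega>)\<^sup>2) \<in> H" for n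
    using sq_in_H[of "Suc n"] by (simp add: U_def)
  have W2_eq: "(\<lambda>\<omega>. (W n \<omega>)\<^sup>2) = (\<lambda>\<omega>. (c n)\<^sup>2 * (U n \<omega>)\<^sup>2)" for n
    by (simp add: W_def power_mult_distrib)
  have "qs (\<lambda>\<omega>. summable (\<lambda>n. W n \<omega>))"
  proof (rule qs_summable_independent)
    show "W n \<in> H" for n unfolding W_def[abs_def] using UH by auto
    show "W n \<in> borel_measurable (MF (Suc n))" for n
      unfolding W_def[abs_def] U_def using Xm[of n] by measurable
    show "e (W n) = 0" for n
      using e_scale[OF UH, of "c n" n] e_add_const[OF XH, of n "- e (X (Suc n))"] c[of n]
      by (simp add: W_def[abs_def] U_def[abs_def])
    show "(\<lambda>\<omega>. (W n \<omega>)\<^sup>2) \<in> H" for n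
      unfolding W2_eq using U2H by auto
    have "e (\<lambda>\<omega>. (W n \<omega>)\<^sup>2) = e (\<lambda>\<omega>. (U n \<omega>)\<^sup>2) / (b (Suc n))\<^sup>2" for n
      unfolding W2_eq using e_scale[OF U2H, of "(c n)\<^sup>2" n] by (simp add: c_def power_divide)
    then show "summable (\<lambda>n. e (\<lambda>\<omega>. (W n \<omega>)\<^sup>2))"
      using summ by (simp add: U_def)
    fix n and f :: "real \<Rightarrow> real"
    assume f: "f \<in> borel_measurable borel" and fW: "(\<lambda>\<omega>. f (W n \<omega>)) \<in> H"
    \<comment> \<open>Any Borel function of \<open>W n\<close> is one of \<open>X (Suc n)\<close>,
      so \<open>indep_E\<close> supplies the conditional means.\<close>
    have "(\<lambda>x. f (c n * (x - e (X (Suc n))))) \<in> borel_measurable borel"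
      using f by measurable
    from indep_E[OF _ this, of "X (Suc n)" n]
    show "qs (\<lambda>\<omega>. E n (\<lambda>\<omega>. f (W n \<omega>)) \<omega> = e (\<lambda>\<omega>. f (W n \<omega>)))"
      using X_indep[of "Suc n"] fW by (simp add: W_def U_def)
  qed
  then show ?thesis
  proof (rule qs_mono)
    fix \<omega> assume s: "summable (\<lambda>n. W n \<omega>)"
    \<comment> \<open>Positivity and monotonicity of \<open>b\<close> start at index 1, hence the
      shifted weights.\<close>
    have "(\<lambda>n. (\<Sum>i\<le>n. b (Suc i) * W i \<omega>) / b (Suc n)) \<longlonglongrightarrow> 0"
      using b b_incr b_lim by (intro kronecker[OF s]) (auto simp: filterlim_sequentially_Suc)
    moreover have "(\<Sum>i\<le>n. b (Suc i) * W i \<omega>) = (\<Sum>i=1..Suc n. X i \<omega> - e (X i))" for n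
    proof -
      have "(\<Sum>i\<le>n. b (Suc i) * W i \<omega>) = (\<Sum>i\<le>n. X (Suc i) \<omega> - e (X (Suc i)))"
        using b by (intro sum.cong) (auto simp: W_def c_def U_def less_imp_neq[symmetric])
      also have "\<dots> = (\<Sum>i=1..Suc n. X i \<omega> - e (X i))"
        using sum.shift_bounds_cl_Suc_ivl[of "\<lambda>i. X i \<omega> - e (X i)" 0 n]
        by (simp add: atLeast0AtMost)
      finally show ?thesis .
    qed
    ultimately have "(\<lambda>n. (\<Sum>i=1..Suc n. X i \<omega> - e (X i)) / b (Suc n)) \<longlonglongrightarrow> 0" by simp
    then show "(\<lambda>n. (\<Sum>i=1..n. X i \<omega> - e (X i)) / b n) \<longlonglongrightarrow> 0"
      by (rule LIMSEQ_imp_Suc)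
  qed
qed

end
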